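(* Let $n\ge 2$ and let $\mathcal{M}\subset\mathbb{R}^n$ be a connected real analytic submanifold with $\dim(\mathcal{M})\ge 2$ that is not contained in any rational affine hyperplane of $\mathbb{R}^n$. Then there are uncountably many vectors $x\in\mathcal{M}$ such that $x$ does not lie on any rational affine hyperplane of $\mathbb{R}^n$ and $x$ is $w$-singular for every weight $w\in(0,1)^n$.
   Context: A weight is a vector $w=(w_1,\dots,w_n)\in[0,1]^n$ with $w_1+\dots+w_n=1$. For a weight $w$ define the quasi-norm $\|y\|_w:=\max_{i:\,w_i\neq 0}|y_i|^{1/w_i}$ for $y\in\mathbb{R}^n$. A vector $x\in\mathbb{R}^n$ is $w$-singular if for every $\delta>0$ there exists $Q_0>0$ such that for every $Q>Q_0$ there is $(p,q)\in\mathbb{Z}^n\times\mathbb{N}$ with $\|qx-p\|_w\le \delta/Q$ and $0<q\le Q$. A rational affine hyperplane is an affine hyperplane of $\mathbb{R}^n$ defined by an equation with rational coefficients. *)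

theory Defs
  imports "HOL-Analysis.Analysis"
begin

text \<open>Multi-indices are functions \<open>'n \<Rightarrow> nat\<close> on the finite type \<open>'n\<close>; the convergence of the
  power series is unconditional, i.e. independent of the ordering of the multi-indices.\<close>

definition real_analytic_at :: "(real ^ 'n \<Rightarrow> 'b :: real_normed_vector) \<Rightarrow> real ^ 'n \<Rightarrow> bool" where
  "real_analytic_at f a \<longleftrightarrow>
     (\<exists>r>0. \<exists>c :: ('n \<Rightarrow> nat) \<Rightarrow> 'b. \<forall>x\<in>ball a r.
        ((\<lambda>\<alpha>. (\<Prod>i\<in>UNIV. (x $ i - a $ i) ^ \<alpha> i) *\<^sub>R c \<alpha>) has_sum f x) UNIV)"

definition real_analytic_on :: "(real ^ 'n \<Rightarrow> 'b :: real_normed_vector) \<Rightarrow> (real ^ 'n) set \<Rightarrow> bool" where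
  "real_analytic_on f U \<longleftrightarrow> (\<forall>a\<in>U. real_analytic_at f a)"

text \<open>Embedded submanifolds, described by slice charts: around each of its points, \<open>M\<close> is straightened
  to a \<open>d\<close>-dimensional linear subspace by a real analytic diffeomorphism between open subsets of
  the ambient space.\<close>

definition real_analytic_submanifold :: "nat \<Rightarrow> (real ^ 'n) set \<Rightarrow> bool" where
  "real_analytic_submanifold d M \<longleftrightarrow>
     (\<forall>x\<in>M. \<exists>U V \<phi> \<psi> L.
        open U \<and> open V \<and> x \<in> U \<and> homeomorphism U V \<phi> \<psi> \<and>
        real_analytic_on \<phi> U \<and> real_analytic_on \<psi> V \<and>
        subspace (L :: (real ^ 'n) set) \<and> dim L = d \<and> \<phi> ` (U \<inter> M) = V \<inter> L)"

definition rational_affine_hyperplane :: "(real ^ 'n) set \<Rightarrow> bool" where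
  "rational_affine_hyperplane H \<longleftrightarrow>
     (\<exists>a b. a \<noteq> 0 \<and> (\<forall>i. a $ i \<in> \<rat>) \<and> b \<in> \<rat> \<and> H = {x. a \<bullet> x = b})"

definition is_weight :: "real ^ 'n \<Rightarrow> bool" where
  "is_weight w \<longleftrightarrow> (\<forall>i. 0 \<le> w $ i \<and> w $ i \<le> 1) \<and> (\<Sum>i\<in>UNIV. w $ i) = 1"

definition weighted_quasinorm :: "real ^ 'n \<Rightarrow> real ^ 'n \<Rightarrow> real" where
  "weighted_quasinorm w y = Max ((\<lambda>i. \<bar>y $ i\<bar> powr (1 / w $ i)) ` {i. w $ i \<noteq> 0})"

definition weighted_singular :: "real ^ 'n \<Rightarrow> real ^ 'n \<Rightarrow> bool" where
  "weighted_singular w x \<longleftrightarrow>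
     (\<forall>\<delta>>0. \<exists>Q\<^sub>0>0. \<forall>Q>Q\<^sub>0. \<exists>(p :: int ^ 'n) (q :: nat).
        weighted_quasinorm w (real q *\<^sub>R x - (\<chi> i. real_of_int (p $ i))) \<le> \<delta> / Q \<and>
        0 < q \<and> real q \<le> Q)"

end

theory Submission
  imports Defs
begin

text \<open>
  Khintchine's construction. If \<open>x\<close> is close to the hyperplane \<open>a \<bullet> z = b\<close> with integral \<open>a\<close> and \<open>b\<close>, choose \<open>j\<close> with \<open>a\<^sub>j \<noteq> 0\<close> and \<open>w\<^sub>j\<close> minimal. Dirichlet's theorem in the remaining \<open>n - 1\<close>
  coordinates yields \<open>q'\<close>, and \<open>q = \<bar>a\<^sub>j\<bar> q'\<close> approximates all \<open>n\<close> coordinates; the gain from saving the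
  exponent \<open>w\<^sub>j > 0\<close> beats every constant depending on \<open>a\<close> once \<open>Q\<close> is large. Hence \<open>x\<close> is singular for
  all weights simultaneously as soon as there are hyperplanes \<open>a\<^sub>k \<bullet> z = b\<^sub>k\<close> to which \<open>x\<close> is close enough in
  terms of the height of \<open>a\<^sub>k\<^sub>+\<^sub>1\<close>.

  Such points are found as limits of points \<open>y\<^sub>k\<close> of \<open>M\<close> at which \<open>d\<close> suitable coordinates, forming local
  topological coordinates of \<open>M\<close>, are rational. From \<open>y\<^sub>k\<close> one moves in a rational direction \<open>v\<close> of these coordinates;
  as \<open>d \<ge> 2\<close> there is a rational hyperplane containing this line, and \<open>y\<^sub>k\<^sub>+\<^sub>1\<close> is taken on it arbitrarily close
  to \<open>y\<^sub>k\<close>. A hyperplane not containing \<open>M\<close> is avoided by choosing \<open>v\<close> outside the zero set of the leading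
  homogeneous part of its equation at \<open>y\<^sub>k\<close>; only the differentiability of the coordinates at \<open>y\<^sub>k\<close> is
  needed for this, not an analytic inverse function theorem. Countable families of hyperplanes can be avoided,
  and avoiding \<open>{z. z\<^sub>i = x\<^sub>i}\<close> for \<open>x\<close> in a countable set shows that the set of points obtained is uncountable.
\<close>

section \<open>Real analytic functions\<close>

lemma abs_has_sum_le:
  fixes f g :: "'a \<Rightarrow> real"
  assumes "(f has_sum s) A" "(g has_sum t) A" "\<And>x. x \<in> A \<Longrightarrow> \<bar>f x\<bar> \<le> g x"
  shows "\<bar>s\<bar> \<le> t"
proof -
  have "s \<le> t" using assms by (intro has_sum_mono[OF assms(1,2)]) (auto dest: assms(3))
  moreover have "- s \<le> t"
    using assms(3) by (intro has_sum_mono[OF has_sum_uminusI[OF assms(1)] assms(2)]) (auto dest: assms(3))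
  ultimately show ?thesis by linarith
qed

lemma has_sum_diff:
  fixes f g :: "'a \<Rightarrow> real"
  assumes "(f has_sum s) A" "(g has_sum t) A"
  shows "((\<lambda>x. f x - g x) has_sum (s - t)) A"
  using has_sum_add[OF assms(1) has_sum_uminusI[OF assms(2)]] by simp

section \<open>Estimates for monomials\<close>

lemma abs_monomial_le:
  fixes u :: "real ^ 'n"
  assumes "\<And>i. \<bar>u $ i\<bar> \<le> t"
  shows "\<bar>\<Prod>i\<in>UNIV. u $ i ^ \<alpha> i\<bar> \<le> t ^ (\<Sum>i\<in>UNIV. \<alpha> i)"
proof -
  have "\<bar>\<Prod>i\<in>UNIV. u $ i ^ \<alpha> i\<bar> = (\<Prod>i\<in>UNIV. \<bar>u $ i\<bar> ^ \<alpha> i)"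
    by (simp add: abs_prod power_abs)
  also have "\<dots> \<le> (\<Prod>i\<in>UNIV. t ^ \<alpha> i)"
    by (intro prod_mono) (auto intro: power_mono assms)
  finally show ?thesis by (simp add: power_sum)
qed

text \<open>After division by \<open>t\<close> all coordinates have absolute value at most 1; there
  a difference of products is at most the sum of the differences of the factors, and
  \<open>x ^ k\<close> is \<open>k\<close>-Lipschitz. The form \<open>t ^ deg / t\<close> instead of
  \<open>t ^ (deg - 1)\<close> spares a separate case for degree 0.\<close>

lemma abs_monomial_diff_le:
  fixes u v :: "real ^ 'n"
  assumes "t > 0" "\<And>i. \<bar>u $ i\<bar> \<le> t" "\<And>i. \<bar>v $ i\<bar> \<le> t"
  shows "\<bar>(\<Prod>i\<in>UNIV. u $ i ^ \<alpha> i) - (\<Prod>i\<in>UNIV. v $ i ^ \<alpha> i)\<bar>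
           \<le> real (\<Sum>i\<in>UNIV. \<alpha> i) * t ^ (\<Sum>i\<in>UNIV. \<alpha> i) / t * norm (u - v)"
proof -
  have scale: "(\<Prod>i\<in>UNIV. x $ i ^ \<alpha> i) = t ^ (\<Sum>i\<in>UNIV. \<alpha> i) * (\<Prod>i\<in>UNIV. (x $ i / t) ^ \<alpha> i)"
    for x :: "real ^ 'n"
    using \<open>t > 0\<close> by (simp add: power_sum power_divide flip: prod.distrib)
  have le1: "\<bar>u $ i / t\<bar> \<le> 1" "\<bar>v $ i / t\<bar> \<le> 1" for i
    using assms by (simp_all add: divide_le_eq)
  have "\<bar>(\<Prod>i\<in>UNIV. (u $ i / t) ^ \<alpha> i) - (\<Prod>i\<in>UNIV. (v $ i / t) ^ \<alpha> i)\<bar>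
      \<le> (\<Sum>i\<in>UNIV. \<bar>(u $ i / t) ^ \<alpha> i - (v $ i / t) ^ \<alpha> i\<bar>)"
    using le1 norm_prod_diff[of UNIV "\<lambda>i. (u $ i / t) ^ \<alpha> i" "\<lambda>i. (v $ i / t) ^ \<alpha> i"]
    by (simp add: power_le_one power_abs)
  also have "\<dots> \<le> (\<Sum>i\<in>UNIV. real (\<alpha> i) * (norm (u - v) / t))"
  proof (rule sum_mono)
    fix i
    have "\<bar>(u $ i / t) ^ \<alpha> i - (v $ i / t) ^ \<alpha> i\<bar> \<le> real (\<alpha> i) * \<bar>u $ i / t - v $ i / t\<bar>"
      using le1 norm_power_diff[of "u $ i / t" "v $ i / t" "\<alpha> i"] by simp
    also have "\<bar>u $ i / t - v $ i / t\<bar> = \<bar>(u - v) $ i\<bar> / t"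
      using \<open>t > 0\<close> by (simp add: diff_divide_distrib[symmetric])
    also have "\<dots> \<le> norm (u - v) / t"
      using \<open>t > 0\<close> component_le_norm_cart[of "u - v" i] by (simp add: divide_right_mono)
    finally show "\<bar>(u $ i / t) ^ \<alpha> i - (v $ i / t) ^ \<alpha> i\<bar> \<le> real (\<alpha> i) * (norm (u - v) / t)"
      by (simp add: mult_left_mono)
  qed
  also have "\<dots> = real (\<Sum>i\<in>UNIV. \<alpha> i) * (norm (u - v) / t)"
    by (simp add: sum_distrib_right sum_divide_distrib)
  finally have "t ^ (\<Sum>i\<in>UNIV. \<alpha> i) * \<bar>(\<Prod>i\<in>UNIV. (u $ i / t) ^ \<alpha> i) - (\<Prod>i\<in>UNIV. (v $ i / t) ^ \<alpha> i)\<bar>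
      \<le> t ^ (\<Sum>i\<in>UNIV. \<alpha> i) * (real (\<Sum>i\<in>UNIV. \<alpha> i) * (norm (u - v) / t))"
    using \<open>t > 0\<close> by (intro mult_left_mono) auto
  then show ?thesis
    unfolding scale[of u] scale[of v] using \<open>t > 0\<close>
    by (simp add: abs_mult mult_ac flip: right_diff_distrib)
qed

lemma finite_multi_indices_le:
  "finite {\<alpha> :: 'n::finite \<Rightarrow> nat. (\<Sum>i\<in>UNIV. \<alpha> i) \<le> k}"
proof (rule finite_subset)
  show "{\<alpha> :: 'n \<Rightarrow> nat. (\<Sum>i\<in>UNIV. \<alpha> i) \<le> k} \<subseteq> PiE UNIV (\<lambda>_. {..k})"
  proof
    fix \<alpha> :: "'n \<Rightarrow> nat" assume "\<alpha> \<in> {\<alpha>. (\<Sum>i\<in>UNIV. \<alpha> i) \<le> k}"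
    moreover have "\<alpha> i \<le> (\<Sum>i\<in>UNIV. \<alpha> i)" for i
      by (rule member_le_sum) auto
    ultimately show "\<alpha> \<in> PiE UNIV (\<lambda>_. {..k})"
      by (auto intro: order_trans)
  qed
qed (auto intro: finite_PiE)

section \<open>Power series and their homogeneous parts\<close>

lemma real_analytic_at_inner:
  assumes "real_analytic_at f a"
  shows "real_analytic_at (\<lambda>x. v \<bullet> f x :: real) a"
proof -
  from assms obtain r c where r: "r > 0" and
    c: "\<And>x. x \<in> ball a r \<Longrightarrow> ((\<lambda>\<alpha>. (\<Prod>i\<in>UNIV. (x $ i - a $ i) ^ \<alpha> i) *\<^sub>R c \<alpha>) has_sum f x) UNIV"
    unfolding real_analytic_at_def by blast
  have "((\<lambda>\<alpha>. (\<Prod>i\<in>UNIV. (x $ i - a $ i) ^ \<alpha> i) *\<^sub>R (v \<bullet> c \<alpha>)) has_sum v \<bullet> f x) UNIV"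
    if "x \<in> ball a r" for x
    using has_sum_bounded_linear[OF bounded_linear_inner_right[of v] c[OF that]] by simp
  with r show ?thesis unfolding real_analytic_at_def by (intro exI[of _ r] conjI exI ballI)
qed

lemma real_analytic_at_diff_const:
  fixes f :: "real ^ 'n \<Rightarrow> real"
  assumes "real_analytic_at f a"
  shows "real_analytic_at (\<lambda>x. f x - b) a"
proof -
  from assms obtain r c where r: "r > 0" and
    c: "\<And>x. x \<in> ball a r \<Longrightarrow> ((\<lambda>\<alpha>. (\<Prod>i\<in>UNIV. (x $ i - a $ i) ^ \<alpha> i) *\<^sub>R c \<alpha>) has_sum f x) UNIV"
    unfolding real_analytic_at_def by blast
  have "((\<lambda>\<alpha>. (\<Prod>i\<in>UNIV. (x $ i - a $ i) ^ \<alpha> i) *\<^sub>R (c \<alpha> - (if \<alpha> = (\<lambda>_. 0) then b else 0)))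
      has_sum (f x - b)) UNIV"
    if "x \<in> ball a r" for x
  proof -
    have "((\<lambda>\<alpha>. (\<Prod>i\<in>UNIV. (x $ i - a $ i) ^ \<alpha> i) *\<^sub>R (if \<alpha> = (\<lambda>_. 0) then b else 0))
      has_sum (\<Sum>\<alpha>\<in>{\<lambda>_::'n. 0::nat}. (\<Prod>i\<in>UNIV. (x $ i - a $ i) ^ \<alpha> i) *\<^sub>R (if \<alpha> = (\<lambda>_. 0) then b else 0))) UNIV"
      by (rule has_sum_finite_neutralI[of "{\<lambda>_. 0}"]) auto
    then have "((\<lambda>\<alpha>. (\<Prod>i\<in>UNIV. (x $ i - a $ i) ^ \<alpha> i) *\<^sub>R (if \<alpha> = (\<lambda>_. 0) then b else 0)) has_sum b) UNIV"
      by simp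
    from has_sum_diff[OF c[OF that] this] show ?thesis
      by (simp add: algebra_simps)
  qed
  with r show ?thesis unfolding real_analytic_at_def by (intro exI[of _ r] conjI exI ballI)
qed

text \<open>Unconditional convergence of a real series is absolute. Applied at the point with all
  coordinates equal to \<rho>, it yields the majorant on which the expansion estimates below
  rest.\<close>

lemma real_analytic_at_coefficients:
  fixes f :: "real ^ 'n \<Rightarrow> real"
  assumes "real_analytic_at f a"
  obtains \<rho> c where "\<rho> > 0"
    and "\<And>u. norm u \<le> \<rho> \<Longrightarrow> ((\<lambda>\<alpha>. c \<alpha> * (\<Prod>i\<in>UNIV. u $ i ^ \<alpha> i)) has_sum f (a + u)) UNIV"
    and "(\<lambda>\<alpha>. \<bar>c \<alpha>\<bar> * \<rho> ^ (\<Sum>i\<in>UNIV. \<alpha> i)) summable_on UNIV"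
proof -
  from assms obtain r c where r: "r > 0" and
    c: "\<And>x. x \<in> ball a r \<Longrightarrow> ((\<lambda>\<alpha>. (\<Prod>i\<in>UNIV. (x $ i - a $ i) ^ \<alpha> i) *\<^sub>R c \<alpha>) has_sum f x) UNIV"
    unfolding real_analytic_at_def by blast
  have sum: "((\<lambda>\<alpha>. c \<alpha> * (\<Prod>i\<in>UNIV. u $ i ^ \<alpha> i)) has_sum f (a + u)) UNIV" if "norm u < r" for u
    using c[of "a + u"] that by (simp add: dist_norm mult.commute)
  \<comment> \<open>The diagonal point has 1-norm \<open>CARD('n) * \<rho>\<close>, which must stay
    below \<open>r\<close>.\<close>
  define \<rho> where "\<rho> = r / (real CARD('n) + 1)"
  have \<rho>: "\<rho> > 0" using r by (simp add: \<rho>_def)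
  have \<rho>r: "\<rho> * real CARD('n) < r" "\<rho> < r"
    using r zero_less_card_finite[where 'a='n] by (simp_all add: \<rho>_def field_simps)
  define w :: "real ^ 'n" where "w = (\<chi> i. \<rho>)"
  have "norm w \<le> (\<Sum>i\<in>UNIV. \<bar>w $ i\<bar>)" by (rule norm_le_l1_cart)
  also have "\<dots> < r" using \<rho>r \<rho> by (simp add: w_def mult.commute)
  finally have "(\<lambda>\<alpha>. c \<alpha> * (\<Prod>i\<in>UNIV. w $ i ^ \<alpha> i)) summable_on UNIV"
    using sum has_sum_imp_summable by blast
  then have "(\<lambda>\<alpha>. norm (c \<alpha> * (\<Prod>i\<in>UNIV. w $ i ^ \<alpha> i))) summable_on UNIV"
    by (subst summable_on_iff_abs_summable_on_real[symmetric])
  moreover have "norm (c \<alpha> * (\<Prod>i\<in>UNIV. w $ i ^ \<alpha> i)) = \<bar>c \<alpha>\<bar> * \<rho> ^ (\<Sum>i\<in>UNIV. \<alpha> i)" for \<alpha>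
    using \<rho> by (simp add: w_def power_sum abs_mult abs_prod)
  ultimately have "(\<lambda>\<alpha>. \<bar>c \<alpha>\<bar> * \<rho> ^ (\<Sum>i\<in>UNIV. \<alpha> i)) summable_on UNIV" by simp
  then show ?thesis using that[OF \<rho>, of c] sum \<rho>r by fastforce
qed

text \<open>Terms are grouped by degree. A term of degree at least \<open>m\<close> is at most its
  majorant term times \<open>(norm u / \<rho>) ^ m\<close>, which bounds the remainder for all
  \<open>m\<close> with the same constant \<open>A\<close>.\<close>

lemma real_analytic_at_homogeneous_expansion:
  fixes f :: "real ^ 'n \<Rightarrow> real"
  assumes "real_analytic_at f a"
  obtains \<rho> A P where "\<rho> > 0" and "A \<ge> 0"
    and "\<And>k :: nat. continuous_on UNIV (P k)"
    and "\<And>k s u. P k (s *\<^sub>R u) = s ^ k * P k u"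
    and "\<And>m u. norm u \<le> \<rho> \<Longrightarrow> \<bar>f (a + u) - (\<Sum>k<m. P k u)\<bar> \<le> A * (norm u / \<rho>) ^ m"
proof -
  obtain \<rho> c where \<rho>: "\<rho> > 0"
    and sum: "\<And>u. norm u \<le> \<rho> \<Longrightarrow> ((\<lambda>\<alpha>. c \<alpha> * (\<Prod>i\<in>UNIV. u $ i ^ \<alpha> i)) has_sum f (a + u)) UNIV"
    and summ: "(\<lambda>\<alpha>. \<bar>c \<alpha>\<bar> * \<rho> ^ (\<Sum>i\<in>UNIV. \<alpha> i)) summable_on UNIV"
    by (rule real_analytic_at_coefficients[OF assms]) blast
  define deg where "deg \<alpha> = (\<Sum>i\<in>UNIV. \<alpha> i)" for \<alpha> :: "'n \<Rightarrow> nat"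
  define A where "A = (\<Sum>\<^sub>\<infinity>\<alpha>. \<bar>c \<alpha>\<bar> * \<rho> ^ deg \<alpha>)"
  define P where "P = (\<lambda>k u. \<Sum>\<alpha> | deg \<alpha> = k. c \<alpha> * (\<Prod>i\<in>UNIV. u $ i ^ \<alpha> i))"
  have A0: "A \<ge> 0" unfolding A_def using \<rho> by (intro infsum_nonneg) auto
  have fin: "finite {\<alpha>. deg \<alpha> = k}" for k
    by (rule finite_subset[OF _ finite_multi_indices_le[of k]]) (auto simp: deg_def)
  have fin': "finite {\<alpha>. deg \<alpha> < m}" for m
    by (rule finite_subset[OF _ finite_multi_indices_le[of m]]) (auto simp: deg_def)
  have hom: "P k (s *\<^sub>R u) = s ^ k * P k u" for k s u
    unfolding P_def sum_distrib_left
    by (rule sum.cong) (auto simp: power_mult_distrib prod.distrib deg_def mult_ac simp flip: power_sum)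
  have cont: "continuous_on UNIV (P k)" for k
    unfolding P_def by (intro continuous_intros)
  have rem: "\<bar>f (a + u) - (\<Sum>k<m. P k u)\<bar> \<le> A * (norm u / \<rho>) ^ m" if u: "norm u \<le> \<rho>" for m u
  proof -
    let ?g = "\<lambda>\<alpha>. c \<alpha> * (\<Prod>i\<in>UNIV. u $ i ^ \<alpha> i)"
    have "(\<Sum>k<m. P k u) = sum ?g (\<Union>k<m. {\<alpha>. deg \<alpha> = k})"
      unfolding P_def by (subst sum.UNION_disjoint) (auto simp: fin)
    also have "(\<Union>k<m. {\<alpha>. deg \<alpha> = k}) = {\<alpha>. deg \<alpha> < m}" by auto
    finally have "(?g has_sum (f (a + u) - (\<Sum>k<m. P k u))) (UNIV - {\<alpha>. deg \<alpha> < m})"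
      using has_sum_Diff[OF sum[OF u] has_sum_finite[OF fin'[of m]]] by simp
    moreover have "((\<lambda>\<alpha>. (\<bar>c \<alpha>\<bar> * \<rho> ^ deg \<alpha>) * (norm u / \<rho>) ^ m) has_sum
        (\<Sum>\<^sub>\<infinity>\<alpha>\<in>UNIV - {\<alpha>. deg \<alpha> < m}. \<bar>c \<alpha>\<bar> * \<rho> ^ deg \<alpha>) * (norm u / \<rho>) ^ m) (UNIV - {\<alpha>. deg \<alpha> < m})"
      by (intro has_sum_cmult_left has_sum_infsum summable_on_subset_banach[OF summ[folded deg_def]]) auto
    moreover have "norm (?g \<alpha>) \<le> (\<bar>c \<alpha>\<bar> * \<rho> ^ deg \<alpha>) * (norm u / \<rho>) ^ m"
      if "\<alpha> \<in> UNIV - {\<alpha>. deg \<alpha> < m}" for \<alpha>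
    proof -
      have "norm (?g \<alpha>) \<le> \<bar>c \<alpha>\<bar> * norm u ^ deg \<alpha>"
        using abs_monomial_le[of u "norm u" \<alpha>] component_le_norm_cart[of u]
        by (auto simp: abs_mult deg_def intro!: mult_left_mono)
      also have "norm u ^ deg \<alpha> = \<rho> ^ deg \<alpha> * (norm u / \<rho>) ^ deg \<alpha>"
        using \<rho> by (simp add: power_divide)
      also have "(norm u / \<rho>) ^ deg \<alpha> \<le> (norm u / \<rho>) ^ m"
        using that \<rho> u by (intro power_decreasing) auto
      finally show ?thesis using \<rho> by (simp add: mult_left_mono mult.assoc)
    qed
    ultimately have "norm (f (a + u) - (\<Sum>k<m. P k u))
        \<le> (\<Sum>\<^sub>\<infinity>\<alpha>\<in>UNIV - {\<alpha>. deg \<alpha> < m}. \<bar>c \<alpha>\<bar> * \<rho> ^ deg \<alpha>) * (norm u / \<rho>) ^ m"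
      unfolding real_norm_def by (rule abs_has_sum_le)
    also have "(\<Sum>\<^sub>\<infinity>\<alpha>\<in>UNIV - {\<alpha>. deg \<alpha> < m}. \<bar>c \<alpha>\<bar> * \<rho> ^ deg \<alpha>) \<le> A"
      unfolding A_def using \<rho> summ[folded deg_def]
      by (intro infsum_mono_neutral) (auto intro: summable_on_subset_banach[OF summ[folded deg_def]])
    finally show ?thesis using \<rho> by (simp add: mult_right_mono)
  qed
  show ?thesis by (rule that[OF \<rho> A0 cont hom rem])
qed

section \<open>Strict differentiability\<close>

lemma linear_monomial_of_degree_one:
  assumes "(\<Sum>i\<in>UNIV. \<alpha> i) = (1::nat)"
  shows "linear (\<lambda>u :: real ^ 'n. \<Prod>i\<in>UNIV. u $ i ^ \<alpha> i)"
proof -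
  from assms have "\<exists>j. \<alpha> j = 1 \<and> (\<forall>i. i \<noteq> j \<longrightarrow> \<alpha> i = 0)"
    by (subst (asm) sum_eq_1_iff) auto
  then obtain j where j: "\<alpha> j = 1" "\<And>i. i \<noteq> j \<Longrightarrow> \<alpha> i = 0"
    by blast
  have "(\<Prod>i\<in>UNIV. u $ i ^ \<alpha> i) = u $ j" for u :: "real ^ 'n"
    using j by (subst prod.remove[of _ j]) auto
  then show ?thesis by (simp add: linear_iff)
qed

text \<open>A two-point estimate, stronger than differentiability at \<open>a\<close>: it yields
  Lipschitz bounds and injectivity near \<open>a\<close> without an inverse function theorem. Degree
  0 cancels, degree 1 is \<open>D\<close>, and on a ball of radius \<open>t\<close> the terms of
  degree at least 2 have a Lipschitz constant of order \<open>t\<close>.\<close>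

lemma real_analytic_at_strict_derivative_real:
  fixes f :: "real ^ 'n \<Rightarrow> real"
  assumes "real_analytic_at f a"
  obtains D where "linear D"
    and "\<And>e. e > 0 \<Longrightarrow> \<exists>\<delta>>0. \<forall>x\<in>ball a \<delta>. \<forall>y\<in>ball a \<delta>. \<bar>f x - f y - D (x - y)\<bar> \<le> e * norm (x - y)"
proof -
  obtain \<rho> c where \<rho>: "\<rho> > 0"
    and sum: "\<And>u. norm u \<le> \<rho> \<Longrightarrow> ((\<lambda>\<alpha>. c \<alpha> * (\<Prod>i\<in>UNIV. u $ i ^ \<alpha> i)) has_sum f (a + u)) UNIV"
    and summ: "(\<lambda>\<alpha>. \<bar>c \<alpha>\<bar> * \<rho> ^ (\<Sum>i\<in>UNIV. \<alpha> i)) summable_on UNIV"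
    by (rule real_analytic_at_coefficients[OF assms]) blast
  define deg where "deg \<alpha> = (\<Sum>i\<in>UNIV. \<alpha> i)" for \<alpha> :: "'n \<Rightarrow> nat"
  define A where "A = (\<Sum>\<^sub>\<infinity>\<alpha>. \<bar>c \<alpha>\<bar> * \<rho> ^ deg \<alpha>)"
  define D where "D = (\<lambda>u. \<Sum>\<alpha> | deg \<alpha> = 1. c \<alpha> * (\<Prod>i\<in>UNIV. u $ i ^ \<alpha> i))"
  have A0: "A \<ge> 0" unfolding A_def using \<rho> by (intro infsum_nonneg) auto
  have fin: "finite {\<alpha>. deg \<alpha> = k}" for k
    by (rule finite_subset[OF _ finite_multi_indices_le[of k]]) (auto simp: deg_def)
  have fin2: "finite {\<alpha>. deg \<alpha> < 2}"
    by (rule finite_subset[OF _ finite_multi_indices_le[of 2]]) (auto simp: deg_def)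
  have lin: "linear D"
    unfolding D_def
    using linear_compose_scale_right[OF linear_monomial_of_degree_one, unfolded real_scaleR_def]
    by (intro linear_compose_sum ballI) (simp add: deg_def)
  have bound: "\<bar>f (a + u) - f (a + v) - D (u - v)\<bar> \<le> A * (4 * t / \<rho>\<^sup>2) * norm (u - v)"
    if t: "t > 0" "2 * t \<le> \<rho>" and uv: "norm u \<le> t" "norm v \<le> t" for t u v
  proof -
    define g where "g = (\<lambda>\<alpha>. c \<alpha> * ((\<Prod>i\<in>UNIV. u $ i ^ \<alpha> i) - (\<Prod>i\<in>UNIV. v $ i ^ \<alpha> i)))"
    have "norm u \<le> \<rho>" "norm v \<le> \<rho>" using t uv by linarith+
    then have g: "(g has_sum (f (a + u) - f (a + v))) UNIV"
      unfolding g_def right_diff_distrib by (intro has_sum_diff sum)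
    have "sum g {\<alpha>. deg \<alpha> < 2} = sum g ({\<alpha>. deg \<alpha> = 0} \<union> {\<alpha>. deg \<alpha> = 1})"
      by (rule sum.cong) auto
    also have "\<dots> = sum g {\<alpha>. deg \<alpha> = 0} + sum g {\<alpha>. deg \<alpha> = 1}"
      by (rule sum.union_disjoint) (auto simp: fin)
    also have "sum g {\<alpha>. deg \<alpha> = 0} = 0"
      by (rule sum.neutral) (auto simp: g_def deg_def)
    also have "sum g {\<alpha>. deg \<alpha> = 1} = D u - D v"
      by (simp add: g_def D_def right_diff_distrib sum_subtractf)
    also have "\<dots> = D (u - v)" using lin by (simp add: linear_diff)
    finally have "(g has_sum (f (a + u) - f (a + v) - D (u - v))) (UNIV - {\<alpha>. deg \<alpha> < 2})"
      using has_sum_Diff[OF g has_sum_finite[OF fin2]] by simp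
    moreover have "((\<lambda>\<alpha>. (\<bar>c \<alpha>\<bar> * \<rho> ^ deg \<alpha>) * (4 * t / \<rho>\<^sup>2 * norm (u - v))) has_sum
        (\<Sum>\<^sub>\<infinity>\<alpha>\<in>UNIV - {\<alpha>. deg \<alpha> < 2}. \<bar>c \<alpha>\<bar> * \<rho> ^ deg \<alpha>) * (4 * t / \<rho>\<^sup>2 * norm (u - v))) (UNIV - {\<alpha>. deg \<alpha> < 2})"
      by (intro has_sum_cmult_left has_sum_infsum summable_on_subset_banach[OF summ[folded deg_def]]) auto
    moreover have "norm (g \<alpha>) \<le> (\<bar>c \<alpha>\<bar> * \<rho> ^ deg \<alpha>) * (4 * t / \<rho>\<^sup>2 * norm (u - v))"
      if "\<alpha> \<in> UNIV - {\<alpha>. deg \<alpha> < 2}" for \<alpha>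
    proof -
      have "\<bar>u $ i\<bar> \<le> t" "\<bar>v $ i\<bar> \<le> t" for i
        using uv component_le_norm_cart[of u i] component_le_norm_cart[of v i] by linarith+
      from abs_monomial_diff_le[OF t(1) this]
      have "norm (g \<alpha>) \<le> \<bar>c \<alpha>\<bar> * (real (deg \<alpha>) * t ^ deg \<alpha> / t * norm (u - v))"
        unfolding g_def real_norm_def abs_mult deg_def by (rule mult_left_mono) simp
      \<comment> \<open>The factor \<open>deg \<alpha>\<close> is absorbed by doubling the radius,
        which is why \<open>2 * t \<le> \<rho>\<close> is required.\<close>
      also have "real (deg \<alpha>) * t ^ deg \<alpha> \<le> 2 ^ deg \<alpha> * t ^ deg \<alpha>"
        using t of_nat_less_two_power[of "deg \<alpha>", where 'a=real] by (intro mult_right_mono) auto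
      also have "2 ^ deg \<alpha> * t ^ deg \<alpha> = \<rho> ^ deg \<alpha> * (2 * t / \<rho>) ^ deg \<alpha>"
        using \<rho> by (simp add: power_divide power_mult_distrib)
      also have "(2 * t / \<rho>) ^ deg \<alpha> \<le> (2 * t / \<rho>) ^ 2"
        using that \<rho> t by (intro power_decreasing) auto
      finally have "norm (g \<alpha>) \<le> \<bar>c \<alpha>\<bar> * (\<rho> ^ deg \<alpha> * (2 * t / \<rho>) ^ 2 / t * norm (u - v))"
        using \<rho> t by (simp add: mult_left_mono mult_right_mono divide_right_mono)
      also have "(2 * t / \<rho>) ^ 2 = 4 * t / \<rho>\<^sup>2 * t"
        by (simp add: power2_eq_square)
      finally show ?thesis using t by (simp add: mult_ac)
    qed
    ultimately have "norm (f (a + u) - f (a + v) - D (u - v))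
        \<le> (\<Sum>\<^sub>\<infinity>\<alpha>\<in>UNIV - {\<alpha>. deg \<alpha> < 2}. \<bar>c \<alpha>\<bar> * \<rho> ^ deg \<alpha>) * (4 * t / \<rho>\<^sup>2 * norm (u - v))"
      unfolding real_norm_def by (rule abs_has_sum_le)
    also have "\<dots> \<le> A * (4 * t / \<rho>\<^sup>2 * norm (u - v))"
    proof (rule mult_right_mono)
      show "(\<Sum>\<^sub>\<infinity>\<alpha>\<in>UNIV - {\<alpha>. deg \<alpha> < 2}. \<bar>c \<alpha>\<bar> * \<rho> ^ deg \<alpha>) \<le> A"
        unfolding A_def using \<rho> summ[folded deg_def]
        by (intro infsum_mono_neutral) (auto intro: summable_on_subset_banach[OF summ[folded deg_def]])
    qed (use t in simp)
    finally show ?thesis by (simp add: mult.assoc)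
  qed
  have "\<exists>\<delta>>0. \<forall>x\<in>ball a \<delta>. \<forall>y\<in>ball a \<delta>. \<bar>f x - f y - D (x - y)\<bar> \<le> e * norm (x - y)" if "e > 0" for e
  proof -
    \<comment> \<open>The second entry makes the Lipschitz constant
      \<open>A * (4 * t / \<rho>\<^sup>2)\<close> at most \<open>e\<close>; \<open>A + 1\<close>
      keeps the denominator positive.\<close>
    define t where "t = min (\<rho> / 2) (e * \<rho>\<^sup>2 / (4 * (A + 1)))"
    have t: "t > 0" "2 * t \<le> \<rho>" using \<rho> A0 that by (auto simp: t_def)
    have "t \<le> e * \<rho>\<^sup>2 / (4 * (A + 1))" by (simp add: t_def)
    then have "(A + 1) * (4 * t / \<rho>\<^sup>2) \<le> e"
      using \<rho> A0 by (simp add: field_simps)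
    moreover have "A * (4 * t / \<rho>\<^sup>2) \<le> (A + 1) * (4 * t / \<rho>\<^sup>2)"
      using \<rho> t by (intro mult_right_mono) auto
    ultimately have e: "A * (4 * t / \<rho>\<^sup>2) \<le> e" by linarith
    have "\<bar>f x - f y - D (x - y)\<bar> \<le> e * norm (x - y)" if "x \<in> ball a t" "y \<in> ball a t" for x y
    proof -
      have "\<bar>f x - f y - D (x - y)\<bar> \<le> A * (4 * t / \<rho>\<^sup>2) * norm (x - y)"
        using bound[OF t, of "x - a" "y - a"] that by (simp add: dist_norm norm_minus_commute)
      also have "\<dots> \<le> e * norm (x - y)" using e by (intro mult_right_mono) auto
      finally show ?thesis .
    qed
    with t show ?thesis by blast
  qed
  with lin show ?thesis by (rule that)
qed

lemma real_analytic_at_strict_derivative: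
  fixes f :: "real ^ 'n \<Rightarrow> real ^ 'm"
  assumes "real_analytic_at f a"
  obtains D where "linear D"
    and "\<And>e. e > 0 \<Longrightarrow> \<exists>\<delta>>0. \<forall>x\<in>ball a \<delta>. \<forall>y\<in>ball a \<delta>. norm (f x - f y - D (x - y)) \<le> e * norm (x - y)"
proof -
  have "\<exists>D. linear D \<and> (\<forall>e>0. \<exists>\<delta>>0. \<forall>x\<in>ball a \<delta>. \<forall>y\<in>ball a \<delta>. \<bar>f x $ i - f y $ i - D (x - y)\<bar> \<le> e * norm (x - y))"
    for i
  proof -
    have "real_analytic_at (\<lambda>x. f x $ i) a"
      using real_analytic_at_inner[OF assms, of "axis i 1"] by (simp add: inner_axis')
    then show ?thesis by (rule real_analytic_at_strict_derivative_real) blast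
  qed
  then obtain D where D: "\<And>i. linear (D i)"
    "\<And>i e. e > 0 \<Longrightarrow> \<exists>\<delta>>0. \<forall>x\<in>ball a \<delta>. \<forall>y\<in>ball a \<delta>. \<bar>f x $ i - f y $ i - D i (x - y)\<bar> \<le> e * norm (x - y)"
    by metis
  define E where "E = (\<lambda>u. \<chi> i. D i u)"
  have "linear E"
    unfolding E_def linear_iff by (auto simp: vec_eq_iff linear_add[OF D(1)] linear_cmul[OF D(1)])
  moreover have "\<exists>\<delta>>0. \<forall>x\<in>ball a \<delta>. \<forall>y\<in>ball a \<delta>. norm (f x - f y - E (x - y)) \<le> e * norm (x - y)"
    if "e > 0" for e
  proof -
    define e' where "e' = e / real CARD('m)"
    have "e' > 0" using that by (simp add: e'_def)
    then obtain \<delta> where \<delta>: "\<And>i. \<delta> i > 0"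
      "\<And>i x y. x \<in> ball a (\<delta> i) \<Longrightarrow> y \<in> ball a (\<delta> i) \<Longrightarrow> \<bar>f x $ i - f y $ i - D i (x - y)\<bar> \<le> e' * norm (x - y)"
      using D(2)[of e'] by metis
    define \<delta>0 where "\<delta>0 = Min (range \<delta>)"
    have pos: "\<delta>0 > 0" unfolding \<delta>0_def using \<delta>(1) by (subst Min_gr_iff) auto
    have le: "\<delta>0 \<le> \<delta> i" for i unfolding \<delta>0_def by (rule Min_le) auto
    have "norm (f x - f y - E (x - y)) \<le> e * norm (x - y)" if "x \<in> ball a \<delta>0" "y \<in> ball a \<delta>0" for x y
    proof -
      have "norm (f x - f y - E (x - y)) \<le> (\<Sum>i\<in>UNIV. \<bar>(f x - f y - E (x - y)) $ i\<bar>)"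
        by (rule norm_le_l1_cart)
      also have "\<dots> \<le> (\<Sum>i\<in>(UNIV :: 'm set). e' * norm (x - y))"
      proof (rule sum_mono)
        fix i :: 'm
        have "x \<in> ball a (\<delta> i)" "y \<in> ball a (\<delta> i)" using that le[of i] by auto
        then show "\<bar>(f x - f y - E (x - y)) $ i\<bar> \<le> e' * norm (x - y)"
          using \<delta>(2) by (simp add: E_def)
      qed
      also have "\<dots> = e * norm (x - y)" by (simp add: e'_def)
      finally show ?thesis .
    qed
    with pos show ?thesis by blast
  qed
  ultimately show ?thesis by (rule that)
qed

section \<open>Leading homogeneous parts and zeros\<close>

text \<open>Division by \<open>s\<close> brings \<open>u\<close> close to \<open>u0\<close>, so
  \<open>P u\<close> has size at least a constant times \<open>\<bar>s\<bar> ^ m\<close> and beats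
  the remainder of order \<open>m + 1\<close>. A whole sector is needed, because the points
  constructed later follow a direction only up to a small multiple of \<open>s\<close>.\<close>

lemma homogeneous_leading_part_nonzero:
  fixes g :: "real ^ 'n \<Rightarrow> real"
  assumes P: "continuous_on UNIV P" "\<And>s u. P (s *\<^sub>R u) = s ^ m * P u" "P u0 \<noteq> 0"
    and \<rho>: "\<rho> > 0" "C \<ge> 0"
    and rem: "\<And>u. u \<in> K \<Longrightarrow> norm u \<le> \<rho> \<Longrightarrow> \<bar>g (a + u) - P u\<bar> \<le> C * norm u ^ Suc m"
  obtains \<delta> \<eta> where "\<delta> > 0" "\<eta> > 0"
    "\<And>s u. 0 < \<bar>s\<bar> \<Longrightarrow> \<bar>s\<bar> < \<delta> \<Longrightarrow> u \<in> K \<Longrightarrow> norm (u - s *\<^sub>R u0) \<le> \<eta> * \<bar>s\<bar> \<Longrightarrow> g (a + u) \<noteq> 0"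
proof -
  define p where "p = \<bar>P u0\<bar> / 2"
  have p: "p > 0" using P(3) by (simp add: p_def)
  obtain d where d: "d > 0" "\<And>u. dist u u0 < d \<Longrightarrow> dist (P u) (P u0) < p"
    using P(1) p unfolding continuous_on_iff by (metis UNIV_I)
  \<comment> \<open>\<open>\<eta> \<le> 1\<close> bounds \<open>norm u\<close> by
    \<open>\<bar>s\<bar> * B\<close>, and \<open>\<eta> < d\<close> keeps the rescaled value of
    \<open>P\<close> within \<open>p\<close> of \<open>P u0\<close>. In \<delta> the first entry
    keeps \<open>u\<close> within radius \<rho>, the second makes the remainder smaller than
    \<open>\<bar>s\<bar> ^ m * p\<close>.\<close>
  define \<eta> where "\<eta> = min 1 (d / 2)"
  define B where "B = norm u0 + 1"
  define \<delta> where "\<delta> = min (\<rho> / B) (p / (C * B ^ Suc m + 1))"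
  have B: "B > 0" by (simp add: B_def add_nonneg_pos)
  have CB: "C * B ^ Suc m \<ge> 0" using B \<rho> by simp
  show ?thesis
  proof
    have "C * B ^ Suc m + 1 > 0" using CB by linarith
    then show "\<delta> > 0" "\<eta> > 0"
      using d(1) p B \<rho>(1) by (simp_all add: \<delta>_def \<eta>_def)
    fix s u assume s: "0 < \<bar>s\<bar>" "\<bar>s\<bar> < \<delta>" and u: "u \<in> K" "norm (u - s *\<^sub>R u0) \<le> \<eta> * \<bar>s\<bar>"
    define e where "e = (1 / s) *\<^sub>R u - u0"
    have us: "u = s *\<^sub>R (u0 + e)" using s by (simp add: e_def)
    then have "norm (u - s *\<^sub>R u0) = \<bar>s\<bar> * norm e" by (simp add: algebra_simps)
    then have e: "norm e \<le> \<eta>" using u(2) s by (simp add: mult.commute)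
    then have "dist (u0 + e) u0 < d" using d(1) by (simp add: dist_norm \<eta>_def min_def split: if_splits)
    from d(2)[OF this] have Pe: "\<bar>P (u0 + e)\<bar> > p"
      unfolding dist_real_def p_def by linarith
    have "norm (u0 + e) \<le> B" using e norm_triangle_ineq[of u0 e] by (simp add: B_def \<eta>_def)
    then have nu: "norm u \<le> \<bar>s\<bar> * B" unfolding us by (simp add: mult_left_mono)
    have "\<bar>s\<bar> * B \<le> \<rho>" using s B by (simp add: \<delta>_def field_simps)
    with nu have "\<bar>g (a + u) - P u\<bar> \<le> C * norm u ^ Suc m" using rem u(1) by simp
    also have "\<dots> \<le> C * (\<bar>s\<bar> * B) ^ Suc m"
      using nu \<rho> by (intro mult_left_mono power_mono) auto
    also have "\<dots> = \<bar>s\<bar> ^ m * (\<bar>s\<bar> * (C * B ^ Suc m))"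
      by (simp add: power_mult_distrib)
    also have "\<dots> < \<bar>s\<bar> ^ m * p"
    proof (rule mult_strict_left_mono)
      have "\<bar>s\<bar> * (C * B ^ Suc m) \<le> \<bar>s\<bar> * (C * B ^ Suc m + 1)" by (intro mult_left_mono) auto
      also have "\<dots> < p" using s(2) CB by (simp add: \<delta>_def pos_less_divide_eq)
      finally show "\<bar>s\<bar> * (C * B ^ Suc m) < p" .
    qed (use s in simp)
    also have "\<dots> \<le> \<bar>s\<bar> ^ m * \<bar>P (u0 + e)\<bar>" using Pe by (intro mult_left_mono) auto
    also have "\<dots> = \<bar>P u\<bar>" unfolding us P(2) by (simp add: abs_mult power_abs)
    finally show "g (a + u) \<noteq> 0" by auto
  qed
qed

text \<open>If all homogeneous parts vanish on \<open>K\<close>, the remainder bound tends to 0 as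
  \<open>m\<close> grows; otherwise the part of least degree not vanishing identically on
  \<open>K\<close> dominates. Below, \<open>K\<close> is a line or the linear model \<open>L\<close>
  of the submanifold.\<close>

lemma real_analytic_zero_or_nonzero_sector:
  fixes g :: "real ^ 'n \<Rightarrow> real"
  assumes "real_analytic_at g a" and K: "\<And>s u. u \<in> K \<Longrightarrow> s *\<^sub>R u \<in> K"
  shows "(\<exists>\<rho>>0. \<forall>u\<in>K. norm u < \<rho> \<longrightarrow> g (a + u) = 0) \<or>
    (\<exists>u0\<in>K. \<exists>\<delta>>0. \<exists>\<eta>>0. \<forall>s u. 0 < \<bar>s\<bar> \<longrightarrow> \<bar>s\<bar> < \<delta> \<longrightarrow> u \<in> K \<longrightarrow>
        norm (u - s *\<^sub>R u0) \<le> \<eta> * \<bar>s\<bar> \<longrightarrow> g (a + u) \<noteq> 0)"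
proof -
  obtain \<rho> A P where \<rho>: "\<rho> > 0" "A \<ge> 0"
    and P: "\<And>k :: nat. continuous_on UNIV (P k)" "\<And>k s u. P k (s *\<^sub>R u) = s ^ k * P k u"
    and rem: "\<And>m u. norm u \<le> \<rho> \<Longrightarrow> \<bar>g (a + u) - (\<Sum>k<m. P k u)\<bar> \<le> A * (norm u / \<rho>) ^ m"
    by (rule real_analytic_at_homogeneous_expansion[OF assms(1)]) blast
  show ?thesis
  proof (cases "\<exists>k. \<exists>u\<in>K. P k u \<noteq> 0")
    case False
    have "g (a + u) = 0" if u: "u \<in> K" "norm u < \<rho>" for u
    proof -
      have "\<bar>g (a + u)\<bar> \<le> A * (norm u / \<rho>) ^ m" for m
        using rem[of u m] u False by simp
      moreover have "(\<lambda>m. A * (norm u / \<rho>) ^ m) \<longlonglongrightarrow> A * 0"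
        using u \<rho> by (intro tendsto_mult_left LIMSEQ_power_zero) simp
      ultimately have "\<bar>g (a + u)\<bar> \<le> A * 0" by (intro LIMSEQ_le_const) auto
      then show ?thesis by simp
    qed
    then show ?thesis using \<rho> by blast
  next
    case True
    define m where "m = (LEAST k. \<exists>u\<in>K. P k u \<noteq> 0)"
    from LeastI_ex[OF True] obtain u0 where u0: "u0 \<in> K" "P m u0 \<noteq> 0" unfolding m_def by blast
    have low: "P k u = 0" if "k < m" "u \<in> K" for k u
      using not_less_Least[of k "\<lambda>k. \<exists>u\<in>K. P k u \<noteq> 0"] that unfolding m_def[symmetric] by blast
    have bound: "\<bar>g (a + u) - P m u\<bar> \<le> A / \<rho> ^ Suc m * norm u ^ Suc m" if "u \<in> K" "norm u \<le> \<rho>" for u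
      using rem[OF that(2), of "Suc m"] low[OF _ that(1)] by (simp add: power_divide)
    have "A / \<rho> ^ Suc m \<ge> 0" using \<rho> by simp
    from homogeneous_leading_part_nonzero[OF P(1,2) u0(2) \<rho>(1) this bound]
    obtain \<delta> \<eta> where "\<delta> > 0" "\<eta> > 0"
      "\<And>s u. 0 < \<bar>s\<bar> \<Longrightarrow> \<bar>s\<bar> < \<delta> \<Longrightarrow> u \<in> K \<Longrightarrow> norm (u - s *\<^sub>R u0) \<le> \<eta> * \<bar>s\<bar> \<Longrightarrow> g (a + u) \<noteq> 0"
      by blast
    then show ?thesis using u0(1) by blast
  qed
qed

text \<open>The case where \<open>K\<close> is the line spanned by \<open>v\<close>. The direction
  found is \<open>t0 *\<^sub>R v\<close>, where \<open>t0 = 0\<close> may occur, for instance when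
  \<open>g a \<noteq> 0\<close>.\<close>

lemma real_analytic_zero_or_isolated_on_line:
  fixes g :: "real ^ 'n \<Rightarrow> real"
  assumes "real_analytic_at g a"
  shows "(\<exists>e>0. \<forall>t. \<bar>t\<bar> < e \<longrightarrow> g (a + t *\<^sub>R v) = 0) \<or>
    (\<exists>e>0. \<forall>t. 0 < \<bar>t\<bar> \<longrightarrow> \<bar>t\<bar> < e \<longrightarrow> g (a + t *\<^sub>R v) \<noteq> 0)"
proof -
  let ?K = "range (\<lambda>t. t *\<^sub>R v)"
  have K: "s *\<^sub>R u \<in> ?K" if "u \<in> ?K" for s u using that by auto
  consider \<rho> where "\<rho> > 0" "\<forall>u\<in>?K. norm u < \<rho> \<longrightarrow> g (a + u) = 0"
    | t0 \<delta> \<eta> where "\<delta> > 0" "\<eta> > 0" "\<forall>s u. 0 < \<bar>s\<bar> \<longrightarrow> \<bar>s\<bar> < \<delta> \<longrightarrow> u \<in> ?K \<longrightarrow>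
        norm (u - s *\<^sub>R (t0 *\<^sub>R v)) \<le> \<eta> * \<bar>s\<bar> \<longrightarrow> g (a + u) \<noteq> 0"
    using real_analytic_zero_or_nonzero_sector[OF assms K] by blast
  then show ?thesis
  proof cases
    case 1
    have "g (a + t *\<^sub>R v) = 0" if "\<bar>t\<bar> < \<rho> / (norm v + 1)" for t
    proof -
      have "\<bar>t\<bar> * (norm v + 1) < \<rho>" using that by (simp add: pos_less_divide_eq add_nonneg_pos)
      then have "norm (t *\<^sub>R v) < \<rho>" by (simp add: algebra_simps)
      then show ?thesis using 1(2) by blast
    qed
    moreover have "\<rho> / (norm v + 1) > 0" using 1(1) by (simp add: add_nonneg_pos)
    ultimately show ?thesis by blast
  next
    case 2
    \<comment> \<open>\<open>c\<close> is chosen such that \<open>t v\<close> lies in the sector at scale \<open>c t\<close>.\<close>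
    define c where "c = (if t0 = 0 then norm v / \<eta> + 1 else 1 / t0)"
    have c: "c \<noteq> 0" using 2(2) by (simp add: c_def add_nonneg_eq_0_iff)
    have "g (a + t *\<^sub>R v) \<noteq> 0" if "0 < \<bar>t\<bar>" "\<bar>t\<bar> < \<delta> / \<bar>c\<bar>" for t
    proof -
      have "norm (t *\<^sub>R v - (c * t) *\<^sub>R (t0 *\<^sub>R v)) \<le> \<eta> * \<bar>c * t\<bar>"
      proof (cases "t0 = 0")
        case True
        have "\<bar>t\<bar> * norm v \<le> \<bar>t\<bar> * (norm v + \<eta>)" using 2(2) by (intro mult_left_mono) auto
        also have "norm v + \<eta> = \<eta> * \<bar>c\<bar>" using True 2(2) by (simp add: c_def field_simps)
        also have "\<bar>t\<bar> * (\<eta> * \<bar>c\<bar>) = \<eta> * \<bar>c * t\<bar>" by (simp add: abs_mult)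
        finally show ?thesis using True by simp
      qed (use 2(2) in \<open>simp add: c_def\<close>)
      moreover have "0 < \<bar>c * t\<bar>" "\<bar>c * t\<bar> < \<delta>"
        using that c by (auto simp: abs_mult pos_less_divide_eq mult.commute)
      ultimately show ?thesis using 2(3) by blast
    qed
    moreover have "\<delta> / \<bar>c\<bar> > 0" using 2(1) c by simp
    ultimately show ?thesis by blast
  qed
qed

text \<open>Identity theorem on a segment: the parameters near which \<open>g\<close> vanishes form
  a clopen set. It is closed because zeros accumulate at a limit point, so the alternative of an
  isolated zero is excluded there.\<close>

lemma real_analytic_zero_along_segment:
  fixes g :: "real ^ 'n \<Rightarrow> real"
  assumes an: "\<And>s. s \<in> {0..1} \<Longrightarrow> real_analytic_at g (y + s *\<^sub>R v)"
    and near: "e > 0" "\<And>s. \<bar>s\<bar> < e \<Longrightarrow> g (y + s *\<^sub>R v) = 0"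
  shows "g (y + v) = 0"
proof -
  \<comment> \<open>The neighbourhoods are two-sided on the whole line, also at the end points, so
    openness follows by halving the radius.\<close>
  define E where "E = {s \<in> {0..1::real}. \<exists>e>0. \<forall>t. \<bar>t\<bar> < e \<longrightarrow> g (y + (s + t) *\<^sub>R v) = 0}"
  have "openin (top_of_set {0..1}) E"
  proof (subst openin_euclidean_subtopology_iff, intro conjI ballI)
    fix s assume "s \<in> E"
    then obtain e where e: "e > 0" "\<And>t. \<bar>t\<bar> < e \<Longrightarrow> g (y + (s + t) *\<^sub>R v) = 0"
      by (auto simp: E_def)
    have "x \<in> E" if "x \<in> {0..1}" "dist x s < e / 2" for x
    proof -
      have "g (y + (x + t) *\<^sub>R v) = 0" if "\<bar>t\<bar> < e / 2" for t
      proof -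
        have "\<bar>x - s + t\<bar> < e" using that \<open>dist x s < e / 2\<close> unfolding dist_real_def by linarith
        from e(2)[OF this] show ?thesis by simp
      qed
      then show ?thesis using that e(1) by (auto simp: E_def intro!: exI[of _ "e / 2"])
    qed
    then show "\<exists>e>0. \<forall>x\<in>{0..1}. dist x s < e \<longrightarrow> x \<in> E" using e(1) half_gt_zero by blast
  qed (auto simp: E_def)
  moreover have "closedin (top_of_set {0..1}) E"
  proof (subst closedin_limpt, intro conjI allI impI)
    fix s assume s: "s islimpt E \<and> s \<in> {0..1}"
    have "real_analytic_at g (y + s *\<^sub>R v)" using an s by blast
    from real_analytic_zero_or_isolated_on_line[OF this, of v]
    show "s \<in> E"
    proof (elim disjE exE conjE)
      fix e assume "e > 0" "\<forall>t. \<bar>t\<bar> < e \<longrightarrow> g (y + s *\<^sub>R v + t *\<^sub>R v) = 0"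
      then show "s \<in> E" using s by (auto simp: E_def scaleR_add_left add.assoc)
    next
      fix e assume e: "e > 0" "\<forall>t. 0 < \<bar>t\<bar> \<longrightarrow> \<bar>t\<bar> < e \<longrightarrow> g (y + s *\<^sub>R v + t *\<^sub>R v) \<noteq> 0"
      obtain x where x: "x \<in> E" "x \<noteq> s" "dist x s < e"
        using s e(1) unfolding islimpt_approachable by blast
      from x(1) obtain e' where "e' > 0" "\<forall>t. \<bar>t\<bar> < e' \<longrightarrow> g (y + (x + t) *\<^sub>R v) = 0"
        by (auto simp: E_def)
      then have "g (y + (x + 0) *\<^sub>R v) = 0" by (metis abs_zero)
      moreover have "y + s *\<^sub>R v + (x - s) *\<^sub>R v = y + x *\<^sub>R v" by (simp add: algebra_simps)
      moreover have "g (y + s *\<^sub>R v + (x - s) *\<^sub>R v) \<noteq> 0"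
        using e(2)[rule_format, of "x - s"] x by (simp add: dist_real_def)
      ultimately show "s \<in> E" by (metis add_0_right)
    qed
  qed (auto simp: E_def)
  moreover have "0 \<in> E" using near by (auto simp: E_def)
  moreover have "connected {0..1::real}" by simp
  ultimately have "E = {0..1}" unfolding connected_clopen by blast
  then have "1 \<in> E" by simp
  then obtain e' where "e' > 0" "\<forall>t. \<bar>t\<bar> < e' \<longrightarrow> g (y + (1 + t) *\<^sub>R v) = 0"
    by (auto simp: E_def)
  then have "g (y + (1 + 0) *\<^sub>R v) = 0" by (metis abs_zero)
  then show ?thesis by simp
qed

text \<open>The segment from \<open>z\<close> to \<open>y\<close> stays in \<open>C\<close> by
  convexity and in \<open>L\<close> by linearity. Analyticity holds in the ambient space, while
  vanishing is known only on \<open>L\<close> near \<open>z\<close>.\<close>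

lemma real_analytic_zero_on_convex_slice:
  fixes g :: "real ^ 'n \<Rightarrow> real"
  assumes an: "\<And>y. y \<in> C \<Longrightarrow> real_analytic_at g y" and C: "convex C" and L: "subspace L"
    and z: "z \<in> C \<inter> L" "e > 0" "\<And>y. y \<in> L \<Longrightarrow> dist z y < e \<Longrightarrow> g y = 0"
    and y: "y \<in> C \<inter> L"
  shows "g y = 0"
proof -
  have "g (z + (y - z)) = 0"
  proof (rule real_analytic_zero_along_segment)
    fix s :: real assume s: "s \<in> {0..1}"
    have "z + s *\<^sub>R (y - z) = (1 - s) *\<^sub>R z + s *\<^sub>R y" by (simp add: algebra_simps)
    also have "\<dots> \<in> C" using C z(1) y s by (intro convexD) auto
    finally show "real_analytic_at g (z + s *\<^sub>R (y - z))" by (rule an)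
  next
    show "e / (norm (y - z) + 1) > 0" using z(2) by (simp add: add_nonneg_pos)
    fix s assume "\<bar>s\<bar> < e / (norm (y - z) + 1)"
    then have "\<bar>s\<bar> * (norm (y - z) + 1) < e" by (simp add: pos_less_divide_eq add_nonneg_pos)
    then have "dist z (z + s *\<^sub>R (y - z)) < e" by (simp add: dist_norm distrib_left)
    moreover have "z + s *\<^sub>R (y - z) \<in> L"
      using L z(1) y by (simp add: subspace_add subspace_scale subspace_diff)
    ultimately show "g (z + s *\<^sub>R (y - z)) = 0" by (rule z(3)[rotated])
  qed
  then show ?thesis by simp
qed

section \<open>The identity theorem on a connected submanifold\<close>

lemma real_analytic_submanifold_chart:
  fixes M :: "(real ^ 'n) set"
  assumes "real_analytic_submanifold d M" "x \<in> M"
  obtains U V \<phi> \<psi> and L :: "(real ^ 'n) set" where "open U" "open V" "x \<in> U" "homeomorphism U V \<phi> \<psi>"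
    "real_analytic_on \<phi> U" "real_analytic_on \<psi> V"
    "subspace L" "dim L = d" "\<phi> ` (U \<inter> M) = V \<inter> L"
  using bspec[OF assms(1)[unfolded real_analytic_submanifold_def] assms(2)]
  by (elim exE conjE) (rule that; assumption)

text \<open>The points of \<open>M\<close> near which \<open>M\<close> lies in the hyperplane form a
  clopen subset of \<open>M\<close>; this is where connectedness enters. The contrapositive is what
  is used: no nonempty open piece of \<open>M\<close> lies in a hyperplane that does not contain
  \<open>M\<close>.\<close>

lemma real_analytic_submanifold_in_hyperplane:
  fixes M :: "(real ^ 'n) set"
  assumes M: "real_analytic_submanifold d M" "connected M"
    and W: "open W" "W \<inter> M \<noteq> {}" "\<And>x. x \<in> W \<inter> M \<Longrightarrow> \<alpha> \<bullet> x = \<beta>"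
    and "x \<in> M"
  shows "\<alpha> \<bullet> x = \<beta>"
proof -
  define G where "G = {x \<in> M. \<exists>T. open T \<and> x \<in> T \<and> (\<forall>z\<in>T \<inter> M. \<alpha> \<bullet> z = \<beta>)}"
  have "openin (top_of_set M) G"
    unfolding openin_subopen[of _ G]
  proof (intro ballI)
    fix x assume "x \<in> G"
    then obtain T where "x \<in> M" "open T" "x \<in> T" "\<forall>z\<in>T \<inter> M. \<alpha> \<bullet> z = \<beta>" by (auto simp: G_def)
    then have "openin (top_of_set M) (M \<inter> T) \<and> x \<in> M \<inter> T \<and> M \<inter> T \<subseteq> G"
      by (auto simp: G_def openin_open_Int)
    then show "\<exists>T. openin (top_of_set M) T \<and> x \<in> T \<and> T \<subseteq> G" by blast
  qed
  moreover have "closedin (top_of_set M) G"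
  proof (subst closedin_limpt, intro conjI allI impI)
    fix x assume x: "x islimpt G \<and> x \<in> M"
    then have "x \<in> M" ..
    obtain U V \<phi> \<psi> and L :: "(real ^ 'n) set" where ch: "open U" "open V" "x \<in> U" "homeomorphism U V \<phi> \<psi>"
      "real_analytic_on \<phi> U" "real_analytic_on \<psi> V" "subspace L" "dim L = d" "\<phi> ` (U \<inter> M) = V \<inter> L"
      by (rule real_analytic_submanifold_chart[OF M(1) \<open>x \<in> M\<close>])
    have \<phi>x: "\<phi> x \<in> V" using ch(3,4) by (auto simp: homeomorphism_def)
    then obtain r where r: "r > 0" "ball (\<phi> x) r \<subseteq> V" using ch(2) openE by blast
    \<comment> \<open>\<open>T\<close> is the part of the chart over a ball, since spreading the
      equation from \<open>\<phi> x'\<close> to \<open>\<phi> z\<close> needs a convex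
      domain.\<close>
    define T where "T = U \<inter> \<phi> -` ball (\<phi> x) r"
    have T: "open T" "x \<in> T"
      using ch(1,3,4) r(1) by (auto simp: T_def homeomorphism_def intro: continuous_open_preimage)
    then obtain x' where x': "x' \<in> G" "x' \<in> T" using x unfolding islimpt_def by blast
    then obtain T' where T': "x' \<in> M" "open T'" "x' \<in> T'" "\<forall>z\<in>T' \<inter> M. \<alpha> \<bullet> z = \<beta>" by (auto simp: G_def)
    have \<psi>M: "\<psi> y \<in> U \<inter> M" "\<phi> (\<psi> y) = y" if "y \<in> V \<inter> L" for y
    proof -
      obtain u where "u \<in> U \<inter> M" "y = \<phi> u" using ch(9) \<open>y \<in> V \<inter> L\<close> by blast
      then show "\<psi> y \<in> U \<inter> M" "\<phi> (\<psi> y) = y" using ch(4) by (auto simp: homeomorphism_def)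
    qed
    have x'L: "\<phi> x' \<in> V \<inter> L" "\<psi> (\<phi> x') = x'"
      using ch(4,9) x'(2) T'(1) by (auto simp: T_def homeomorphism_def)
    have "open (V \<inter> \<psi> -` T')" using ch(2,4) T'(2) by (auto simp: homeomorphism_def intro: continuous_open_preimage)
    moreover have "\<phi> x' \<in> V \<inter> \<psi> -` T'" using x'L T'(3) by simp
    ultimately obtain e where e: "e > 0" "ball (\<phi> x') e \<subseteq> V \<inter> \<psi> -` T'" using openE by blast
    have "\<alpha> \<bullet> z = \<beta>" if z: "z \<in> T \<inter> M" for z
    proof -
      have zL: "\<phi> z \<in> V \<inter> L" "\<psi> (\<phi> z) = z" using ch(4,9) z by (auto simp: T_def homeomorphism_def)
      have "\<alpha> \<bullet> \<psi> (\<phi> z) - \<beta> = 0"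
      proof (rule real_analytic_zero_on_convex_slice
          [where C = "ball (\<phi> x) r" and L = L and z = "\<phi> x'" and e = e and g = "\<lambda>y. \<alpha> \<bullet> \<psi> y - \<beta>"])
        show "real_analytic_at (\<lambda>y. \<alpha> \<bullet> \<psi> y - \<beta>) y" if "y \<in> ball (\<phi> x) r" for y
          using ch(6) r(2) that unfolding real_analytic_on_def
          by (intro real_analytic_at_diff_const real_analytic_at_inner) blast
        show "\<phi> x' \<in> ball (\<phi> x) r \<inter> L" "\<phi> z \<in> ball (\<phi> x) r \<inter> L"
          using x'(2) x'L z zL by (auto simp: T_def)
        show "\<alpha> \<bullet> \<psi> y - \<beta> = 0" if "y \<in> L" "dist (\<phi> x') y < e" for y
        proof -
          have "y \<in> V \<inter> L" "\<psi> y \<in> T'" using that e(2) by auto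
          then show ?thesis using \<psi>M(1) T'(4) by simp
        qed
      qed (use ch e in auto)
      then show ?thesis using zL by simp
    qed
    then show "x \<in> G" using T x by (auto simp: G_def)
  qed (auto simp: G_def)
  moreover have "G \<noteq> {}" using W by (auto simp: G_def)
  ultimately have "G = M" using M(2) unfolding connected_clopen by blast
  then show ?thesis using \<open>x \<in> M\<close> by (auto simp: G_def)
qed

section \<open>Approximation near rational hyperplanes\<close>

text \<open>Pigeonhole principle: the multipliers from 0 to the product of the \<open>N i\<close>
  are one more than the boxes with side lengths \<open>1 / N i\<close> that receive the fractional
  parts. Two multipliers with the same box are subtracted.\<close>

lemma weighted_dirichlet_approximation:
  fixes x :: "'a \<Rightarrow> real" and N :: "'a \<Rightarrow> nat"
  assumes "finite J" and N: "\<And>i. i \<in> J \<Longrightarrow> N i > 0"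
  obtains q :: nat and p :: "'a \<Rightarrow> int"
  where "q > 0" "q \<le> (\<Prod>i\<in>J. N i)"
    and "\<And>i. i \<in> J \<Longrightarrow> \<bar>real q * x i - real_of_int (p i)\<bar> \<le> 1 / real (N i)"
proof -
  define f where "f = (\<lambda>q::nat. \<lambda>i\<in>J. nat \<lfloor>real (N i) * frac (real q * x i)\<rfloor>)"
  have "f q \<in> PiE J (\<lambda>i. {..<N i})" for q
  proof -
    have "nat \<lfloor>real (N i) * frac (real q * x i)\<rfloor> < N i" if "i \<in> J" for i
      using N[OF that] frac_lt_1[of "real q * x i"] by (simp add: nat_less_iff floor_less_iff)
    then show ?thesis by (auto simp: f_def)
  qed
  then have "f ` {..\<Prod>i\<in>J. N i} \<subseteq> PiE J (\<lambda>i. {..<N i})" by blast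
  then have "card (f ` {..\<Prod>i\<in>J. N i}) \<le> card (PiE J (\<lambda>i. {..<N i}))"
    using \<open>finite J\<close> by (intro card_mono finite_PiE) auto
  also have "\<dots> < card {..\<Prod>i\<in>J. N i}"
    using \<open>finite J\<close> by (simp add: card_PiE)
  finally have "\<not> inj_on f {..\<Prod>i\<in>J. N i}" by (rule pigeonhole)
  then obtain q1 q2 where q: "q1 < q2" "q2 \<le> (\<Prod>i\<in>J. N i)" "f q1 = f q2"
    unfolding inj_on_def by (metis atMost_iff linorder_neqE_nat)
  show ?thesis
  proof
    show "q2 - q1 > 0" "q2 - q1 \<le> (\<Prod>i\<in>J. N i)" using q by auto
    fix i assume i: "i \<in> J"
    have "f q1 i = f q2 i" using q by simp
    then have "nat \<lfloor>real (N i) * frac (real q1 * x i)\<rfloor> = nat \<lfloor>real (N i) * frac (real q2 * x i)\<rfloor>"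
      using i by (simp add: f_def)
    then have "\<lfloor>real (N i) * frac (real q1 * x i)\<rfloor> = \<lfloor>real (N i) * frac (real q2 * x i)\<rfloor>"
      by (metis mult_nonneg_nonneg eq_nat_nat_iff frac_ge_0 of_nat_0_le_iff zero_le_floor)
    then have "\<bar>real (N i) * frac (real q2 * x i) - real (N i) * frac (real q1 * x i)\<bar> \<le> 1"
      by linarith
    then have "real (N i) * \<bar>frac (real q2 * x i) - frac (real q1 * x i)\<bar> \<le> 1"
      by (simp add: abs_mult flip: right_diff_distrib)
    then have "\<bar>frac (real q2 * x i) - frac (real q1 * x i)\<bar> \<le> 1 / real (N i)"
      using N[OF i] by (simp add: field_simps)
    moreover have "real (q2 - q1) * x i - real_of_int (\<lfloor>real q2 * x i\<rfloor> - \<lfloor>real q1 * x i\<rfloor>)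
        = frac (real q2 * x i) - frac (real q1 * x i)"
      using q by (simp add: frac_def of_nat_diff algebra_simps)
    ultimately show "\<bar>real (q2 - q1) * x i - real_of_int (\<lfloor>real q2 * x i\<rfloor> - \<lfloor>real q1 * x i\<rfloor>)\<bar> \<le> 1 / real (N i)"
      by simp
  qed
qed

text \<open>The base is the constant lost when a Dirichlet approximation is extended along a
  hyperplane with normal \<open>a\<close>. The \<open>m\<close>-th power lets
  \<open>Q powr (1 / m)\<close>, the gain from saving a weight of at least \<open>1 / m\<close>,
  outweigh it.\<close>

definition height_threshold :: "int ^ 'n \<Rightarrow> nat \<Rightarrow> real" where
  "height_threshold a m = ((4 * real_of_int (\<Sum>i\<in>UNIV. \<bar>a $ i\<bar>)) ^ CARD('n) * real m) ^ m"

lemma sum_abs_ge_1: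
  fixes a :: "int ^ 'n"
  assumes "a \<noteq> 0"
  shows "1 \<le> (\<Sum>i\<in>UNIV. \<bar>a $ i\<bar>)"
proof -
  obtain j where "a $ j \<noteq> 0" using assms by (auto simp: vec_eq_iff)
  then have "1 \<le> \<bar>a $ j\<bar>" by simp
  also have "\<dots> \<le> (\<Sum>i\<in>UNIV. \<bar>a $ i\<bar>)" by (rule member_le_sum) auto
  finally show ?thesis .
qed

lemma height_threshold_ge_1:
  assumes "a \<noteq> 0" "m \<ge> 1"
  shows "1 \<le> height_threshold a m"
proof -
  have "1 \<le> 4 * real_of_int (\<Sum>i\<in>UNIV. \<bar>a $ i\<bar>)"
    using sum_abs_ge_1[OF assms(1)] by linarith
  then have "1 * 1 \<le> (4 * real_of_int (\<Sum>i\<in>UNIV. \<bar>a $ i\<bar>)) ^ CARD('a) * real m"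
    using assms(2) by (intro mult_mono one_le_power) auto
  then show ?thesis unfolding height_threshold_def by (simp add: one_le_power)
qed

text \<open>Coordinate \<open>j\<close> costs nothing in Dirichlet's theorem, as the equation of the
  hyperplane recovers it after multiplication by \<open>a $ j\<close>. The remaining weights sum to
  \<open>1 - w $ j \<le> 1 - 1 / m\<close>, so up to constants \<open>q\<close> is smaller than
  \<open>Q\<close> by a factor \<open>Q powr (1 / m)\<close>.\<close>

lemma weighted_approximation_near_hyperplane:
  fixes a :: "int ^ 'n" and x w :: "real ^ 'n"
  assumes "a \<noteq> 0" and m: "m \<ge> 1" and w: "is_weight w" "\<And>i. 1 / real m \<le> w $ i"
    and Q: "height_threshold a m \<le> Q"
    and near: "\<bar>(\<Sum>i\<in>UNIV. real_of_int (a $ i) * x $ i) - real_of_int b\<bar> \<le> 1 / (2 * real m * Q\<^sup>2)"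
  obtains p :: "int ^ 'n" and q :: nat
  where "0 < q" "real q \<le> Q" "\<And>i. \<bar>real q * x $ i - real_of_int (p $ i)\<bar> \<le> (1 / (real m * Q)) powr (w $ i)"
proof -
  define A where "A = real_of_int (\<Sum>i\<in>UNIV. \<bar>a $ i\<bar>)"
  define z where "z = 1 / (real m * Q)"
  have A: "A \<ge> 1" using sum_abs_ge_1[OF assms(1)] unfolding A_def by linarith
  have aA: "\<bar>real_of_int (a $ i)\<bar> \<le> A" for i
  proof -
    have "\<bar>a $ i\<bar> \<le> (\<Sum>i\<in>UNIV. \<bar>a $ i\<bar>)" by (rule member_le_sum) auto
    then show ?thesis unfolding A_def by linarith
  qed
  have Q1: "Q \<ge> 1" using height_threshold_ge_1[OF assms(1) m] Q by linarith
  have mQ: "real m * Q \<ge> 1" using mult_mono[of 1 "real m" 1 Q] m Q1 by simp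
  have z: "0 < z" "z \<le> 1" using mQ by (simp_all add: z_def)
  have w1: "w $ i \<le> 1" for i using w(1) by (simp add: is_weight_def)
  have wpos: "0 < w $ i" for i using w(2)[of i] m by (meson divide_pos_pos less_le_trans of_nat_0_less_iff zero_less_one less_eq_Suc_le One_nat_def)
  let ?S = "{j. a $ j \<noteq> 0}"
  have S: "finite ?S" "?S \<noteq> {}" using assms(1) by (auto simp: vec_eq_iff)
  then have "Min ((\<lambda>j. w $ j) ` ?S) \<in> (\<lambda>j. w $ j) ` ?S" by (intro Min_in) auto
  \<comment> \<open>Minimality of \<open>w $ j\<close> makes the errors
    \<open>z powr (w $ i)\<close> of the other coordinates involved at most
    \<open>z powr (w $ j)\<close>, since \<open>z \<le> 1\<close>.\<close>
  then obtain j where j: "a $ j \<noteq> 0" and "w $ j = Min ((\<lambda>j. w $ j) ` ?S)" by auto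
  then have jmin: "w $ j \<le> w $ i" if "a $ i \<noteq> 0" for i
    using that S by auto
  \<comment> \<open>Dividing by \<open>A\<close> pays for multiplication by entries of
    \<open>a\<close>; the 2 reserves half of the error in coordinate \<open>j\<close> for the
    distance to the hyperplane.\<close>
  define \<epsilon> where "\<epsilon> i = z powr (w $ i) / (2 * A)" for i
  have \<epsilon>: "0 < \<epsilon> i" "\<epsilon> i \<le> 1" for i
  proof -
    show "0 < \<epsilon> i" using z A by (simp add: \<epsilon>_def)
    have "z powr (w $ i) \<le> 1" using z wpos[of i] by (intro powr_le1) auto
    then show "\<epsilon> i \<le> 1" using A by (simp add: \<epsilon>_def)
  qed
  define N where "N i = nat \<lceil>1 / \<epsilon> i\<rceil>" for i
  have N: "N i > 0" "1 / \<epsilon> i \<le> real (N i)" "real (N i) \<le> 4 * A * z powr (- w $ i)" for i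
  proof -
    have ge1: "1 / \<epsilon> i \<ge> 1" using \<epsilon>[of i] by simp
    show "N i > 0" unfolding N_def using \<epsilon>(1)[of i] by simp
    show "1 / \<epsilon> i \<le> real (N i)" unfolding N_def by linarith
    \<comment> \<open>Rounding up at most doubles a number that is at least 1, hence the 4 in
      \<open>height_threshold\<close>.\<close>
    have "real (N i) \<le> 2 * (1 / \<epsilon> i)" unfolding N_def using ge1 by linarith
    also have "\<dots> = 4 * A * z powr (- w $ i)" using z A by (simp add: \<epsilon>_def powr_minus field_simps)
    finally show "real (N i) \<le> 4 * A * z powr (- w $ i)" .
  qed
  obtain q p where q: "q > 0" "q \<le> (\<Prod>i\<in>UNIV - {j}. N i)"
    and p: "\<And>i. i \<in> UNIV - {j} \<Longrightarrow> \<bar>real q * x $ i - real_of_int (p i)\<bar> \<le> 1 / real (N i)"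
    using weighted_dirichlet_approximation[of "UNIV - {j}" N "\<lambda>i. x $ i"] N(1) by auto
  have p\<epsilon>: "\<bar>real q * x $ i - real_of_int (p i)\<bar> \<le> \<epsilon> i" if "i \<noteq> j" for i
  proof -
    have "1 / real (N i) \<le> \<epsilon> i" using N(1,2)[of i] \<epsilon>[of i] by (simp add: field_simps)
    then show ?thesis using p[of i] that by simp
  qed
  have "real q \<le> (\<Prod>i\<in>UNIV - {j}. real (N i))" using q(2) by (simp flip: of_nat_prod)
  also have "\<dots> \<le> (\<Prod>i\<in>UNIV - {j}. 4 * A * z powr (- w $ i))"
    using N(3) by (intro prod_mono) auto
  also have "\<dots> = (4 * A) ^ (CARD('n) - 1) * (\<Prod>i\<in>UNIV - {j}. z powr (- w $ i))"
    by (simp add: prod.distrib)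
  also have "(\<Prod>i\<in>UNIV - {j}. z powr (- w $ i)) = z powr (\<Sum>i\<in>UNIV - {j}. - w $ i)"
    using z by (subst powr_sum) auto
  also have "(\<Sum>i\<in>UNIV - {j}. - w $ i) = - (1 - w $ j)"
    using w(1) sum.remove[of UNIV j "\<lambda>i. w $ i"] by (simp add: is_weight_def sum_negf)
  also have "z powr - (1 - w $ j) = (real m * Q) powr (1 - w $ j)"
  proof -
    have "z = (real m * Q) powr (- 1)" using mQ by (simp add: z_def powr_minus_divide)
    then show ?thesis by (simp only: powr_powr) (simp add: algebra_simps)
  qed
  also have "(real m * Q) powr (1 - w $ j) \<le> (real m * Q) powr (1 - 1 / real m)"
    using mQ w(2)[of j] by (intro powr_mono) auto
  also have "\<dots> = real m powr (1 - 1 / real m) * Q powr (1 - 1 / real m)"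
    using Q1 by (intro powr_mult)
  also have "\<dots> \<le> real m powr 1 * Q powr (1 - 1 / real m)"
    using m by (intro mult_right_mono powr_mono) auto
  finally have "real q \<le> (4 * A) ^ (CARD('n) - 1) * (real m * Q powr (1 - 1 / real m))"
    using A m by (simp add: mult_left_mono)
  then have "\<bar>real_of_int (a $ j)\<bar> * real q \<le> (4 * A) * ((4 * A) ^ (CARD('n) - 1) * (real m * Q powr (1 - 1 / real m)))"
    using aA[of j] A by (intro mult_mono) auto
  also have "\<dots> = (4 * A) ^ CARD('n) * real m * Q powr (1 - 1 / real m)"
    using power_minus_mult[of "CARD('n)" "4 * A"] by (simp add: mult_ac)
  \<comment> \<open>Here the threshold on \<open>Q\<close> is used: the \<open>m\<close>-th power in
    it undoes the exponent \<open>1 / m\<close>.\<close>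
  also have "(4 * A) ^ CARD('n) * real m \<le> Q powr (1 / real m)"
  proof -
    let ?K = "(4 * A) ^ CARD('n) * real m"
    have "?K > 0" using A m by simp
    then have "?K = (?K ^ m) powr (1 / real m)"
      using m by (simp add: powr_powr flip: powr_realpow)
    also have "\<dots> \<le> Q powr (1 / real m)"
      using Q A by (intro powr_mono2) (auto simp: height_threshold_def A_def)
    finally show ?thesis .
  qed
  also have "Q powr (1 / real m) * Q powr (1 - 1 / real m) = Q"
    using Q1 by (simp flip: powr_add)
  finally have qQ: "\<bar>real_of_int (a $ j)\<bar> * real q \<le> Q" by (simp add: mult_right_mono)
  \<comment> \<open>In coordinate \<open>j\<close> the numerator comes from the equation of the
    hyperplane, multiplied by \<open>q\<close> and solved for \<open>a $ j * (q * x $ j)\<close>,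
    with the other \<open>q * x $ i\<close> rounded to \<open>p i\<close>. The sign corrects for the
    denominator \<open>\<bar>a $ j\<bar> * q\<close>.\<close>
  define P where "P = (\<chi> i. if i = j then sgn (a $ j) * (b * int q - (\<Sum>i\<in>UNIV - {j}. a $ i * p i))
      else \<bar>a $ j\<bar> * p i)"
  define q' where "q' = nat \<bar>a $ j\<bar> * q"
  have q': "real q' = \<bar>real_of_int (a $ j)\<bar> * real q" by (simp add: q'_def)
  show ?thesis
  proof
    show "0 < q'" using q(1) j by (simp add: q'_def)
    show "real q' \<le> Q" using qQ q' by simp
    fix i
    show "\<bar>real q' * x $ i - real_of_int (P $ i)\<bar> \<le> (1 / (real m * Q)) powr (w $ i)"
    proof (cases "i = j")
      case False
      then have "real q' * x $ i - real_of_int (P $ i)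
          = \<bar>real_of_int (a $ j)\<bar> * (real q * x $ i - real_of_int (p i))"
        by (simp add: q' P_def algebra_simps)
      then have "\<bar>real q' * x $ i - real_of_int (P $ i)\<bar>
          = \<bar>real_of_int (a $ j)\<bar> * \<bar>real q * x $ i - real_of_int (p i)\<bar>"
        by (simp add: abs_mult)
      also have "\<dots> \<le> A * \<epsilon> i"
        using aA[of j] p\<epsilon>[OF False] A by (intro mult_mono) auto
      also have "\<dots> \<le> z powr (w $ i)" using A by (simp add: \<epsilon>_def)
      finally show ?thesis by (simp add: z_def)
    next
      case True
      define \<eta> where "\<eta> = (\<Sum>i\<in>UNIV. real_of_int (a $ i) * x $ i) - real_of_int b"
      have \<eta>: "\<eta> = real_of_int (a $ j) * x $ j + (\<Sum>i\<in>UNIV - {j}. real_of_int (a $ i) * x $ i) - real_of_int b"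
        unfolding \<eta>_def by (subst sum.remove[of _ j]) auto
      have "real q' * x $ i - real_of_int (P $ i) = sgn (real_of_int (a $ j)) *
         (real q * (real_of_int (a $ j) * x $ j) - real_of_int b * real q + (\<Sum>i\<in>UNIV - {j}. real_of_int (a $ i) * real_of_int (p i)))"
        unfolding q' P_def using True
        by (cases "a $ j" "0 :: int" rule: linorder_cases) (simp_all add: algebra_simps)
      also have "(real q * (real_of_int (a $ j) * x $ j) - real_of_int b * real q + (\<Sum>i\<in>UNIV - {j}. real_of_int (a $ i) * real_of_int (p i)))
          = real q * \<eta> - (\<Sum>i\<in>UNIV - {j}. real_of_int (a $ i) * (real q * x $ i - real_of_int (p i)))"
        unfolding \<eta> by (simp add: algebra_simps sum_subtractf sum_distrib_left)
      finally have "\<bar>real q' * x $ i - real_of_int (P $ i)\<bar>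
          = \<bar>real q * \<eta> - (\<Sum>i\<in>UNIV - {j}. real_of_int (a $ i) * (real q * x $ i - real_of_int (p i)))\<bar>"
        using j by (simp add: abs_mult abs_sgn_eq)
      also have "\<dots> \<le> \<bar>real q * \<eta>\<bar> + \<bar>\<Sum>i\<in>UNIV - {j}. real_of_int (a $ i) * (real q * x $ i - real_of_int (p i))\<bar>"
        by (rule abs_triangle_ineq4)
      also have "\<bar>real q * \<eta>\<bar> \<le> z powr (w $ j) / 2"
      proof -
        have "1 * real q \<le> \<bar>real_of_int (a $ j)\<bar> * real q" using j by (intro mult_right_mono) auto
        then have "real q \<le> Q" using qQ by linarith
        then have "\<bar>real q * \<eta>\<bar> \<le> Q * (1 / (2 * real m * Q\<^sup>2))"
          using near unfolding abs_mult \<eta>_def[symmetric] by (intro mult_mono) auto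
        also have "\<dots> = z / 2" using Q1 by (simp add: z_def power2_eq_square)
        also have "z \<le> z powr (w $ j)" using z w1[of j] powr_mono'[of "w $ j" 1 z] by simp
        finally show ?thesis by simp
      qed
      also have "\<bar>\<Sum>i\<in>UNIV - {j}. real_of_int (a $ i) * (real q * x $ i - real_of_int (p i))\<bar>
          \<le> (\<Sum>i\<in>UNIV - {j}. \<bar>real_of_int (a $ i)\<bar> * (z powr (w $ j) / (2 * A)))"
      proof (rule order_trans[OF sum_abs sum_mono])
        fix i assume i: "i \<in> UNIV - {j}"
        show "\<bar>real_of_int (a $ i) * (real q * x $ i - real_of_int (p i))\<bar>
            \<le> \<bar>real_of_int (a $ i)\<bar> * (z powr (w $ j) / (2 * A))"
        proof (cases "a $ i = 0")
          case False
          have "\<bar>real q * x $ i - real_of_int (p i)\<bar> \<le> \<epsilon> i" using p\<epsilon> i by auto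
          also have "\<epsilon> i \<le> z powr (w $ j) / (2 * A)"
            unfolding \<epsilon>_def using z A jmin[OF False] by (intro divide_right_mono powr_mono') auto
          finally show ?thesis unfolding abs_mult by (rule mult_left_mono) simp
        qed simp
      qed
      also have "\<dots> = (\<Sum>i\<in>UNIV - {j}. \<bar>real_of_int (a $ i)\<bar>) * (z powr (w $ j) / (2 * A))"
        by (rule sum_distrib_right[symmetric])
      also have "\<dots> \<le> A * (z powr (w $ j) / (2 * A))"
      proof (rule mult_right_mono)
        show "(\<Sum>i\<in>UNIV - {j}. \<bar>real_of_int (a $ i)\<bar>) \<le> A"
          unfolding A_def by (simp add: sum_mono2)
      qed (use A in auto)
      also have "\<dots> = z powr (w $ j) / 2" using A by simp
      finally show ?thesis using True by (simp add: z_def)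
    qed
  qed
qed

text \<open>If \<open>\<bar>a\<^sub>k \<bullet> x - b\<^sub>k\<bar> \<le> closeness k a\<^sub>k\<^sub>+\<^sub>1\<close>, then the \<open>k\<close>-th hyperplane serves all \<open>Q\<close> up to the
  threshold of the next one, with \<open>m = k + 1\<close> for the \<open>k\<close>-th hyperplane.\<close>

definition closeness :: "nat \<Rightarrow> int ^ 'n \<Rightarrow> real" where
  "closeness k a = 1 / (2 * real (Suc k) * (max (height_threshold a (Suc (Suc k))) (real (Suc k)))\<^sup>2)"

lemma closeness_pos: "closeness k a > 0"
proof -
  have "max (height_threshold a (Suc (Suc k))) (real (Suc k)) > 0" by (simp add: less_max_iff_disj)
  then show ?thesis unfolding closeness_def by simp
qed

text \<open>The ranges of \<open>Q\<close> served by consecutive hyperplanes leave no gap, whatever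
  the weight is; only the starting index \<open>k0\<close> depends on \<open>w\<close> and
  \<delta>.\<close>

lemma weighted_singular_if_close_hyperplanes:
  fixes a :: "nat \<Rightarrow> int ^ 'n" and b :: "nat \<Rightarrow> int" and x w :: "real ^ 'n"
  assumes "\<And>k. a k \<noteq> 0"
    and near: "\<And>k. \<bar>(\<Sum>i\<in>UNIV. real_of_int (a k $ i) * x $ i) - real_of_int (b k)\<bar> \<le> closeness k (a (Suc k))"
    and w: "is_weight w" "\<And>i. 0 < w $ i"
  shows "weighted_singular w x"
  unfolding weighted_singular_def
proof (intro allI impI)
  fix \<delta> :: real assume \<delta>: "\<delta> > 0"
  \<comment> \<open>From \<open>k0\<close> on, \<open>1 / (k + 1)\<close> is at most \<delta>, which
    gives the bound \<open>\<delta> / Q\<close>, and at most every weight, as the approximation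
    lemma requires.\<close>
  define \<mu> where "\<mu> = min \<delta> (Min (range (\<lambda>i. w $ i)))"
  have "\<mu> > 0" using \<delta> w(2) by (simp add: \<mu>_def)
  then obtain k0 :: nat where "1 / \<mu> < real k0" using reals_Archimedean2 by blast
  then have k0: "1 / real (Suc k) \<le> \<mu>" if "k \<ge> k0" for k
  proof -
    have "1 / \<mu> \<le> real (Suc k)" using that \<open>1 / \<mu> < real k0\<close> by simp
    then show ?thesis using \<open>\<mu> > 0\<close> by (simp add: field_simps)
  qed
  have \<mu>: "\<mu> \<le> \<delta>" "\<mu> \<le> w $ i" for i
    by (auto simp: \<mu>_def min.coboundedI2)
  let ?Q0 = "height_threshold (a k0) (Suc k0)"
  \<comment> \<open>The end of the range of hyperplane \<open>k\<close>. The entry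
    \<open>real (Suc k)\<close> makes it evident that \<open>?U\<close> is unbounded, and keeps
    \<open>closeness\<close> positive for every \<open>a\<close>.\<close>
  let ?U = "\<lambda>k. max (height_threshold (a (Suc k)) (Suc (Suc k))) (real (Suc k))"
  show "\<exists>Q\<^sub>0>0. \<forall>Q>Q\<^sub>0. \<exists>(p :: int ^ 'n) (q :: nat).
        weighted_quasinorm w (real q *\<^sub>R x - (\<chi> i. real_of_int (p $ i))) \<le> \<delta> / Q \<and>
        0 < q \<and> real q \<le> Q"
  proof (intro exI[of _ ?Q0] conjI allI impI)
    show "?Q0 > 0" using height_threshold_ge_1[OF assms(1)[of k0], of "Suc k0"] by simp
    fix Q assume Q: "?Q0 < Q"
    define k where "k = (LEAST k. k0 \<le> k \<and> Q \<le> ?U k)"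
    have ex: "\<exists>k. k0 \<le> k \<and> Q \<le> ?U k"
    proof -
      obtain l :: nat where "Q < real l" using reals_Archimedean2 by blast
      then have "k0 \<le> max k0 l \<and> Q \<le> ?U (max k0 l)" by (auto simp: le_max_iff_disj)
      then show ?thesis by blast
    qed
    have k: "k0 \<le> k" "Q \<le> ?U k" using LeastI_ex[OF ex] by (simp_all add: k_def)
    have lower: "height_threshold (a k) (Suc k) \<le> Q"
    proof (cases "k = k0")
      case True
      then show ?thesis using Q by simp
    next
      case False
      with k have "k0 \<le> k - 1" "k - 1 < k" by auto
      \<comment> \<open>By minimality of \<open>k\<close>, \<open>Q\<close> exceeds
        \<open>?U (k - 1)\<close>, whose first entry is exactly the threshold of hyperplane
        \<open>k\<close>.\<close>
      then have "\<not> Q \<le> ?U (k - 1)" using not_less_Least[of "k - 1" "\<lambda>k. k0 \<le> k \<and> Q \<le> ?U k"]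
        unfolding k_def[symmetric] by blast
      then show ?thesis using \<open>k - 1 < k\<close> by simp
    qed
    have Q1: "Q \<ge> 1" using height_threshold_ge_1[OF assms(1)[of k], of "Suc k"] lower by simp
    have "closeness k (a (Suc k)) \<le> 1 / (2 * real (Suc k) * Q\<^sup>2)"
      unfolding closeness_def using k(2) Q1
      by (intro divide_left_mono mult_left_mono power_mono mult_pos_pos) (auto simp: less_max_iff_disj zero_less_power)
    then have near': "\<bar>(\<Sum>i\<in>UNIV. real_of_int (a k $ i) * x $ i) - real_of_int (b k)\<bar> \<le> 1 / (2 * real (Suc k) * Q\<^sup>2)"
      using near[of k] by linarith
    have wk: "1 / real (Suc k) \<le> w $ i" for i
      using k0[OF k(1)] \<mu>(2)[of i] by linarith
    obtain p q where pq: "0 < q" "real q \<le> Q"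
      "\<And>i. \<bar>real q * x $ i - real_of_int (p $ i)\<bar> \<le> (1 / (real (Suc k) * Q)) powr (w $ i)"
      by (rule weighted_approximation_near_hyperplane[OF assms(1)[of k] _ w(1) wk lower near']) auto
    have "\<bar>(real q *\<^sub>R x - (\<chi> i. real_of_int (p $ i))) $ i\<bar> powr (1 / w $ i) \<le> \<delta> / Q" for i
    proof -
      have "\<bar>(real q *\<^sub>R x - (\<chi> i. real_of_int (p $ i))) $ i\<bar> powr (1 / w $ i)
          \<le> ((1 / (real (Suc k) * Q)) powr (w $ i)) powr (1 / w $ i)"
        using pq(3)[of i] w(2)[of i] by (intro powr_mono2) auto
      also have "\<dots> = 1 / real (Suc k) / Q"
        using w(2)[of i] Q1 by (simp add: powr_powr)
      also have "\<dots> \<le> \<delta> / Q"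
        using k0[OF k(1)] \<mu>(1) Q1 by (intro divide_right_mono) auto
      finally show ?thesis .
    qed
    then have "weighted_quasinorm w (real q *\<^sub>R x - (\<chi> i. real_of_int (p $ i))) \<le> \<delta> / Q"
      unfolding weighted_quasinorm_def using less_imp_neq[OF w(2)]
      by (subst Max_le_iff) auto
    with pq show "\<exists>(p :: int ^ 'n) (q :: nat).
        weighted_quasinorm w (real q *\<^sub>R x - (\<chi> i. real_of_int (p $ i))) \<le> \<delta> / Q \<and>
        0 < q \<and> real q \<le> Q" by blast
  qed
qed

section \<open>Nested neighbourhoods of hyperplanes\<close>

text \<open>The construction in abstract form: \<open>R\<close> stands for the rational points,
  \<Psi> for the required closeness. Each step fixes the next hyperplane through the current point
  before shrinking the ball, because the closeness to the current hyperplane depends on the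
  coefficients of the next one.\<close>

lemma nested_hyperplane_construction:
  fixes \<psi> :: "'a::heine_borel \<Rightarrow> real ^ 'n" and \<alpha> :: "nat \<Rightarrow> real ^ 'n" and \<beta> :: "nat \<Rightarrow> real"
    and \<Psi> :: "nat \<Rightarrow> int ^ 'n \<Rightarrow> real"
  assumes "closed L" "N \<subseteq> L" and N: "\<And>y. y \<in> N \<Longrightarrow> \<exists>\<epsilon>>0. cball y \<epsilon> \<inter> L \<subseteq> N"
    and cont: "continuous_on N \<psi>" and "R \<subseteq> N" "R \<noteq> {}"
    and \<Psi>: "\<And>k a. \<Psi> k a > 0"
    and step: "\<And>y k. y \<in> R \<Longrightarrow> \<exists>a b. a \<noteq> 0 \<and> (\<Sum>i\<in>UNIV. real_of_int (a $ i) * \<psi> y $ i) = real_of_int b \<and>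
       (\<forall>\<epsilon>>0. \<exists>y'\<in>R. dist y y' < \<epsilon> \<and>
         (\<Sum>i\<in>UNIV. real_of_int (a $ i) * \<psi> y' $ i) = real_of_int b \<and> \<alpha> k \<bullet> \<psi> y' \<noteq> \<beta> k)"
  obtains y a b where "y \<in> N" "\<And>k. a k \<noteq> 0"
    "\<And>k. \<bar>(\<Sum>i\<in>UNIV. real_of_int (a k $ i) * \<psi> y $ i) - real_of_int (b k)\<bar> \<le> \<Psi> k (a (Suc k))"
    "\<And>k. \<alpha> k \<bullet> \<psi> y \<noteq> \<beta> k"
proof -
  define lin where "lin a x = (\<Sum>i\<in>UNIV. real_of_int (a $ i) * x $ i)" for a :: "int ^ 'n" and x :: "real ^ 'n"
  define P where "P = (\<lambda>(k::nat) (y, \<epsilon>, a, b). y \<in> R \<and> \<epsilon> > 0 \<and> cball y \<epsilon> \<inter> L \<subseteq> N \<and> a \<noteq> 0 \<and> lin a (\<psi> y) = real_of_int b)"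
  \<comment> \<open>Closeness and avoidance are demanded on the whole smaller ball in
    \<open>L\<close>, so that both hold at the limit point.\<close>
  define T where "T = (\<lambda>k (y, \<epsilon>, a, b) (y', \<epsilon>' :: real, a', b' :: int). cball y' \<epsilon>' \<subseteq> cball y \<epsilon> \<and>
      (\<forall>z\<in>cball y' \<epsilon>' \<inter> L. \<bar>lin a (\<psi> z) - real_of_int b\<bar> \<le> \<Psi> k a' \<and> \<alpha> k \<bullet> \<psi> z \<noteq> \<beta> k))"
  have "\<exists>s. \<forall>k. P k (s k) \<and> T k (s k) (s (Suc k))"
  proof (rule dependent_nat_choice)
    obtain y where y: "y \<in> R" using \<open>R \<noteq> {}\<close> by blast
    then obtain a b where "a \<noteq> 0" "lin a (\<psi> y) = real_of_int b"
      using step[OF y, of 0] unfolding lin_def by blast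
    moreover obtain \<epsilon> where "\<epsilon> > 0" "cball y \<epsilon> \<inter> L \<subseteq> N"
      using N y \<open>R \<subseteq> N\<close> by blast
    ultimately have "P 0 (y, \<epsilon>, a, b)" using y by (simp add: P_def)
    then show "\<exists>s. P 0 s" by blast
  next
    fix s k assume "P k s"
    obtain y \<epsilon> a b where s: "s = (y, \<epsilon>, a, b)" by (cases s) auto
    have y: "y \<in> R" "\<epsilon> > 0" "cball y \<epsilon> \<inter> L \<subseteq> N" "a \<noteq> 0" "lin a (\<psi> y) = real_of_int b"
      using \<open>P k s\<close> by (simp_all add: P_def s)
    obtain a' b' where a': "a' \<noteq> 0" and
      near: "\<And>e. e > 0 \<Longrightarrow> \<exists>y'\<in>R. dist y y' < e \<and> lin a' (\<psi> y') = real_of_int b' \<and> \<alpha> k \<bullet> \<psi> y' \<noteq> \<beta> k"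
      using step[OF y(1), of k] unfolding lin_def by metis
    have "continuous_on N (\<lambda>z. lin a (\<psi> z))"
      unfolding lin_def by (intro continuous_intros cont)
    \<comment> \<open>The old hyperplane also passes through \<open>\<psi> y\<close>; once
      \<open>a'\<close> is known, the admissible deviation from it is a fixed positive
      number.\<close>
    then obtain \<epsilon>1 where \<epsilon>1: "\<epsilon>1 > 0" "\<And>z. z \<in> N \<Longrightarrow> dist z y < \<epsilon>1 \<Longrightarrow> dist (lin a (\<psi> z)) (lin a (\<psi> y)) < \<Psi> k a'"
      using y(1) \<open>R \<subseteq> N\<close> \<Psi>[of k a'] unfolding continuous_on_iff by (metis subsetD)
    define \<epsilon>0 where "\<epsilon>0 = min \<epsilon> \<epsilon>1"
    have \<epsilon>0: "\<epsilon>0 > 0" using y \<epsilon>1 by (simp add: \<epsilon>0_def)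
    obtain y' where y': "y' \<in> R" "dist y y' < \<epsilon>0 / 2" "lin a' (\<psi> y') = real_of_int b'" "\<alpha> k \<bullet> \<psi> y' \<noteq> \<beta> k"
      using near[of "\<epsilon>0 / 2"] \<epsilon>0 by auto
    have "continuous_on N (\<lambda>z. \<alpha> k \<bullet> \<psi> z)"
      by (intro continuous_intros cont)
    then obtain \<epsilon>2 where \<epsilon>2: "\<epsilon>2 > 0" "\<And>z. z \<in> N \<Longrightarrow> dist z y' < \<epsilon>2 \<Longrightarrow> dist (\<alpha> k \<bullet> \<psi> z) (\<alpha> k \<bullet> \<psi> y') < \<bar>\<alpha> k \<bullet> \<psi> y' - \<beta> k\<bar>"
      using y'(1,4) \<open>R \<subseteq> N\<close> unfolding continuous_on_iff
      by (metis subsetD zero_less_abs_iff right_minus_eq)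
    \<comment> \<open>As \<open>y'\<close> is within \<open>\<epsilon>0 / 2\<close> of
      \<open>y\<close>, radius \<open>\<epsilon>0 / 3\<close> stays inside the ball of radius
      \<open>\<epsilon>0\<close>; \<open>\<epsilon>2\<close> protects the avoidance at
      \<open>y'\<close>.\<close>
    define \<epsilon>' where "\<epsilon>' = min (\<epsilon>0 / 3) (\<epsilon>2 / 2)"
    have \<epsilon>': "\<epsilon>' > 0" "\<epsilon>' \<le> \<epsilon>0 / 3" "\<epsilon>' < \<epsilon>2" using \<epsilon>0 \<epsilon>2 by (auto simp: \<epsilon>'_def)
    have close: "dist y z < \<epsilon>0" if "z \<in> cball y' \<epsilon>'" for z
      using that dist_triangle[of y z y'] y'(2) \<epsilon>' \<epsilon>0 by simp
    then have sub: "cball y' \<epsilon>' \<subseteq> cball y \<epsilon>" by (fastforce simp: \<epsilon>0_def)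
    have "P (Suc k) (y', \<epsilon>', a', b')"
      using y' \<epsilon>' a' sub y(3) by (auto simp: P_def)
    moreover have "T k s (y', \<epsilon>', a', b')"
      unfolding T_def s prod.case
    proof (intro conjI ballI sub)
      fix z assume z: "z \<in> cball y' \<epsilon>' \<inter> L"
      then have zN: "z \<in> N" using sub y(3) by blast
      show "\<bar>lin a (\<psi> z) - real_of_int b\<bar> \<le> \<Psi> k a'"
        using \<epsilon>1(2)[OF zN] close[of z] z y(5) by (simp add: \<epsilon>0_def dist_commute dist_real_def)
      have "dist z y' < \<epsilon>2" using z \<epsilon>' by (simp add: dist_commute)
      from \<epsilon>2(2)[OF zN this] show "\<alpha> k \<bullet> \<psi> z \<noteq> \<beta> k"
        by (auto simp: dist_real_def abs_minus_commute)
    qed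
    ultimately show "\<exists>s'. P (Suc k) s' \<and> T k s s'" by blast
  qed
  then obtain s where s: "\<And>k. P k (s k)" "\<And>k. T k (s k) (s (Suc k))" by blast
  define y where "y k = fst (s k)" for k
  define \<epsilon> where "\<epsilon> k = fst (snd (s k))" for k
  define a where "a k = fst (snd (snd (s k)))" for k
  define b where "b k = snd (snd (snd (s k)))" for k
  have sk: "s k = (y k, \<epsilon> k, a k, b k)" for k by (simp add: y_def \<epsilon>_def a_def b_def)
  have Pk: "y k \<in> R" "\<epsilon> k > 0" "cball (y k) (\<epsilon> k) \<inter> L \<subseteq> N" "a k \<noteq> 0" for k
    using s(1)[of k] by (auto simp: P_def sk)
  have Tk: "cball (y (Suc k)) (\<epsilon> (Suc k)) \<subseteq> cball (y k) (\<epsilon> k)"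
    "\<And>z. z \<in> cball (y (Suc k)) (\<epsilon> (Suc k)) \<inter> L \<Longrightarrow> \<bar>lin (a k) (\<psi> z) - real_of_int (b k)\<bar> \<le> \<Psi> k (a (Suc k)) \<and> \<alpha> k \<bullet> \<psi> z \<noteq> \<beta> k"
    for k
    using s(2)[of k] by (auto simp: T_def sk)
  \<comment> \<open>\<open>N\<close> need not be closed; the intersections of the balls with the
    closed set \<open>L\<close> are compact and lie in \<open>N\<close>.\<close>
  have "\<Inter> (range (\<lambda>k. cball (y k) (\<epsilon> k) \<inter> L)) \<noteq> {}"
  proof (rule compact_nest)
    fix k
    have "y k \<in> cball (y k) (\<epsilon> k) \<inter> L"
      using Pk(1,2)[of k] \<open>R \<subseteq> N\<close> \<open>N \<subseteq> L\<close> by auto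
    then show "cball (y k) (\<epsilon> k) \<inter> L \<noteq> {}" by blast
    show "compact (cball (y k) (\<epsilon> k) \<inter> L)"
      using \<open>closed L\<close> by (intro compact_Int_closed compact_cball)
  next
    fix k l :: nat assume "k \<le> l"
    then show "cball (y l) (\<epsilon> l) \<inter> L \<subseteq> cball (y k) (\<epsilon> k) \<inter> L"
      using Tk(1) lift_Suc_antimono_le[of "\<lambda>k. cball (y k) (\<epsilon> k)" k l] by blast
  qed
  then obtain z where z: "\<And>k. z \<in> cball (y k) (\<epsilon> k) \<inter> L" by blast
  show ?thesis
    using that[of z a b] z Pk(3,4) Tk(2) unfolding lin_def by blast
qed

section \<open>Coordinate projections of a chart\<close>

text \<open>The projection stays inside \<open>real ^ 'n\<close>, with zeros outside
  \<open>I\<close>, since \<open>I\<close> is a set and not a type.\<close>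

definition coord_proj :: "'n set \<Rightarrow> real ^ 'n \<Rightarrow> real ^ 'n" where
  "coord_proj I x = (\<chi> i. if i \<in> I then x $ i else 0)"

definition coord_subspace :: "'n set \<Rightarrow> (real ^ 'n) set" where
  "coord_subspace I = {x. \<forall>i. i \<notin> I \<longrightarrow> x $ i = 0}"

lemma linear_coord_proj: "linear (coord_proj I)"
  by (auto simp: linear_iff coord_proj_def vec_eq_iff)

lemma norm_coord_proj_le: "norm (coord_proj I x) \<le> norm x"
  by (rule norm_le_componentwise_cart) (auto simp: coord_proj_def)

lemma coord_proj_in: "coord_proj I x \<in> coord_subspace I"
  by (auto simp: coord_proj_def coord_subspace_def)

lemma subspace_coord_subspace: "subspace (coord_subspace I)"
  by (auto simp: subspace_def coord_subspace_def)

lemma coord_subspace_subset_span: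
  "coord_subspace I \<subseteq> span ((\<lambda>i. axis i 1) ` I :: (real ^ 'n) set)"
proof
  fix x :: "real ^ 'n" assume x: "x \<in> coord_subspace I"
  have "x = (\<Sum>i\<in>UNIV. x $ i *\<^sub>R axis i 1)" by (simp add: basis_expansion scalar_mult_eq_scaleR[symmetric])
  also have "\<dots> \<in> span ((\<lambda>i. axis i 1) ` I)"
  proof (rule span_sum)
    fix i show "x $ i *\<^sub>R axis i 1 \<in> span ((\<lambda>i. axis i 1) ` I)"
      using x by (cases "i \<in> I") (auto simp: coord_subspace_def span_zero intro: span_mul span_base)
  qed
  finally show "x \<in> span ((\<lambda>i. axis i 1) ` I)" .
qed

lemma dim_coord_subspace_le: "dim (coord_subspace I) \<le> card I"
proof -
  have "dim (coord_subspace I) \<le> card ((\<lambda>i. axis i 1 :: real ^ 'a) ` I)"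
    by (rule dim_le_card[OF coord_subspace_subset_span]) simp
  also have "\<dots> \<le> card I" by (rule card_image_le) simp
  finally show ?thesis .
qed

text \<open>Steinitz exchange: a basis of \<open>S\<close> is completed by unit vectors with indices
  in a set \<open>J\<close>. Forgetting the coordinates in \<open>J\<close> has the span of these
  unit vectors as kernel, which meets \<open>S\<close> only in 0; so \<open>I\<close> is the
  complement of \<open>J\<close>.\<close>

lemma injective_coord_proj_exists:
  fixes S :: "(real ^ 'n) set"
  assumes "subspace S"
  obtains I where "card I = dim S" "\<And>x. x \<in> S \<Longrightarrow> coord_proj I x = 0 \<Longrightarrow> x = 0"
proof -
  obtain B where B: "B \<subseteq> S" "independent B" "S \<subseteq> span B" "card B = dim S"
    using basis_exists[of S] by blast
  have "B \<subseteq> B \<union> range (\<lambda>i. axis i 1)" by blast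
  from maximal_independent_subset_extend[OF this B(2)]
  obtain B' where B': "B \<subseteq> B'" "B' \<subseteq> B \<union> range (\<lambda>i. axis i 1)" "independent B'"
    "B \<union> range (\<lambda>i. axis i 1) \<subseteq> span B'" by blast
  have fin: "finite B'" using B'(3) by (rule independent_imp_finite)
  have "coord_subspace UNIV \<subseteq> span (range (\<lambda>i. axis i 1 :: real ^ 'n))"
    by (rule coord_subspace_subset_span)
  also have "\<dots> \<subseteq> span B'" using B'(4) by (intro span_minimal) auto
  finally have spanB': "span B' = UNIV" by (auto simp: coord_subspace_def)
  have cardB': "card B' = CARD('n)"
    using dim_eq_card[OF refl B'(3)] spanB' by (metis dim_span dim_UNIV DIM_cart DIM_real mult.right_neutral)
  define J where "J = {i. axis i 1 \<in> B' - B}"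
  have imJ: "(\<lambda>i. axis i 1) ` J = B' - B" using B'(2) by (auto simp: J_def)
  have "inj_on (\<lambda>i. axis i 1 :: real ^ 'n) J" by (auto simp: inj_on_def axis_eq_axis)
  then have "card J = card (B' - B)" using card_image imJ by metis
  also have "\<dots> = CARD('n) - dim S"
    using card_Diff_subset[of B B'] B'(1) fin cardB' B(4) finite_subset by metis
  finally have "card (- J) = CARD('n) - (CARD('n) - dim S)" by (simp add: Compl_eq_Diff_UNIV card_Diff_subset)
  moreover have "dim S \<le> CARD('n)" using dim_subset_UNIV[of S] by simp
  ultimately have card: "card (- J) = dim S" by simp
  have "x = 0" if x: "x \<in> S" "coord_proj (- J) x = 0" for x
  proof -
    have "x \<in> coord_subspace J"
      using x(2) by (auto simp: coord_proj_def coord_subspace_def vec_eq_iff split: if_splits)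
    then have "x \<in> span (B' - B)" using coord_subspace_subset_span[of J] unfolding imJ by blast
    moreover have "x \<in> span B" using x(1) B(3) by blast
    moreover have "dim (span B \<inter> span (B' - B)) = 0"
    proof -
      have "dim {x + y |x y. x \<in> span B \<and> y \<in> span (B' - B)} + dim (span B \<inter> span (B' - B))
          = dim (span B) + dim (span (B' - B))"
        by (rule dim_sums_Int) auto
      also have "\<dots> = card B + card (B' - B)"
        using B(2) independent_mono[OF B'(3), of "B' - B"] by (simp add: dim_eq_card_independent)
      also have "\<dots> = card B'"
        using B'(1) fin by (metis card_Diff_subset card_mono finite_subset le_add_diff_inverse)
      also have "\<dots> = dim (UNIV :: (real ^ 'n) set)" using cardB' by simp
      also have "UNIV = {x + y |x y. x \<in> span B \<and> y \<in> span (B' - B)}"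
        using spanB' B'(1) span_Un[of B "B' - B"] by (simp add: Un_absorb1)
      finally show ?thesis by simp
    qed
    ultimately show "x = 0" unfolding dim_eq_0 by blast
  qed
  with card show ?thesis by (rule that)
qed

section \<open>Rational vectors and integral hyperplanes\<close>

lemma coord_subspace_rational_dense:
  fixes x :: "real ^ 'n"
  assumes "x \<in> coord_subspace I" "e > 0"
  obtains v where "v \<in> coord_subspace I" "\<And>i. v $ i \<in> \<rat>" "norm (v - x) < e"
proof -
  define e' where "e' = e / (2 * real CARD('n))"
  have e': "e' > 0" using assms by (simp add: e'_def)
  have "\<exists>q\<in>\<rat>. \<bar>q - x $ i\<bar> < e'" for i
    using Rats_dense_in_real[of "x $ i - e'" "x $ i + e'"] e' by (auto simp: abs_less_iff) (metis add.commute diff_less_eq less_diff_eq)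
  then obtain q where q: "\<And>i. q i \<in> \<rat>" "\<And>i. \<bar>q i - x $ i\<bar> < e'" by metis
  define v where "v = (\<chi> i. if i \<in> I then q i else 0)"
  have "\<bar>(v - x) $ i\<bar> \<le> e'" for i
    using q(2)[of i] e' assms(1) by (auto simp: v_def coord_subspace_def)
  then have "(\<Sum>i\<in>UNIV. \<bar>(v - x) $ i\<bar>) \<le> (\<Sum>i\<in>(UNIV :: 'n set). e')" by (intro sum_mono)
  also have "\<dots> < e" using assms(2) by (simp add: e'_def)
  finally have "norm (v - x) < e" using norm_le_l1_cart[of "v - x"] by linarith
  moreover have "v \<in> coord_subspace I" "v $ i \<in> \<rat>" for i
    using q(1) by (auto simp: v_def coord_subspace_def)
  ultimately show ?thesis using that by blast
qed

lemma rational_common_denominator: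
  assumes "finite A" "A \<subseteq> (\<rat> :: real set)"
  obtains N :: int where "N > 0" "\<And>x. x \<in> A \<Longrightarrow> real_of_int N * x \<in> \<int>"
proof -
  from assms have "\<exists>N::int. N > 0 \<and> (\<forall>x\<in>A. real_of_int N * x \<in> \<int>)"
  proof (induction A rule: finite_induct)
    case empty
    show ?case by (rule exI[of _ 1]) simp
  next
    case (insert x A)
    then obtain N where N: "N > 0" "\<And>y. y \<in> A \<Longrightarrow> real_of_int N * y \<in> \<int>" by auto
    from insert.prems have "x \<in> \<rat>" by simp
    then obtain m n where x: "n > 0" "x = real_of_int m / real_of_int n" by (auto elim!: Rats_cases')
    have "real_of_int (n * N) * y \<in> \<int>" if "y \<in> insert x A" for y
    proof (cases "y = x")
      case True
      then have "real_of_int (n * N) * y = real_of_int (N * m)" using x by simp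
      then show ?thesis by (metis Ints_of_int)
    next
      case False
      then have "real_of_int N * y \<in> \<int>" using N(2) that by simp
      then have "real_of_int n * (real_of_int N * y) \<in> \<int>" by (rule Ints_mult[OF Ints_of_int])
      then show ?thesis by (simp add: mult.assoc)
    qed
    then show ?case using x(1) N(1) by (intro exI[of _ "n * N"]) auto
  qed
  then show ?thesis using that by blast
qed

text \<open>Two coordinates in \<open>I\<close> suffice: turning that pair of entries of
  \<open>v\<close> by a right angle gives an orthogonal rational pair, whose denominators are
  cleared. Here dimension at least 2 is used.\<close>

lemma integer_hyperplane_through_direction:
  fixes x v :: "real ^ 'n"
  assumes "card I \<ge> 2" "\<And>i. v $ i \<in> \<rat>" "\<And>i. i \<in> I \<Longrightarrow> x $ i \<in> \<rat>"
  obtains a :: "int ^ 'n" and b :: int where "a \<noteq> 0" "\<And>i. i \<notin> I \<Longrightarrow> a $ i = 0"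
    "(\<Sum>i\<in>UNIV. real_of_int (a $ i) * v $ i) = 0"
    "(\<Sum>i\<in>UNIV. real_of_int (a $ i) * x $ i) = real_of_int b"
proof -
  obtain i j where ij: "i \<in> I" "j \<in> I" "i \<noteq> j"
    using assms(1) by (metis card_2_iff' card_le_Suc0_iff_eq finite_code le_antisym not_less_eq_eq numeral_2_eq_2)
  have "{v $ i, v $ j} \<subseteq> \<rat>" using assms(2) by simp
  from rational_common_denominator[OF _ this]
  obtain N :: int where N: "N > 0" "real_of_int N * v $ i \<in> \<int>" "real_of_int N * v $ j \<in> \<int>"
    by (metis finite.emptyI finite.insertI insertI1 insertI2)
  then obtain vi vj :: int where v: "real_of_int N * v $ i = real_of_int vi" "real_of_int N * v $ j = real_of_int vj"
    by (auto elim!: Ints_cases)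
  \<comment> \<open>For \<open>vi = 0\<close> the pair \<open>(1, 0)\<close> is orthogonal and,
    unlike \<open>(vj, - vi)\<close>, nonzero even if \<open>vj = 0\<close>.\<close>
  define p where "p = (if vi = 0 then 1 else vj)"
  define q where "q = (if vi = 0 then 0 else - vi)"
  have pq: "p \<noteq> 0 \<or> q \<noteq> 0" by (simp add: p_def q_def)
  have "real_of_int N * (real_of_int p * v $ i + real_of_int q * v $ j)
      = real_of_int p * (real_of_int N * v $ i) + real_of_int q * (real_of_int N * v $ j)"
    by (simp add: algebra_simps)
  also have "\<dots> = 0" unfolding v by (simp add: p_def q_def)
  finally have pqv: "real_of_int p * v $ i + real_of_int q * v $ j = 0" using N(1) by simp
  \<comment> \<open>A second denominator, for the point \<open>x\<close>, makes the right-hand side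
    an integer.\<close>
  have "{x $ i, x $ j} \<subseteq> \<rat>" using assms(3) ij by simp
  from rational_common_denominator[OF _ this]
  obtain N' :: int where N': "N' > 0" "real_of_int N' * x $ i \<in> \<int>" "real_of_int N' * x $ j \<in> \<int>"
    by (metis finite.emptyI finite.insertI insertI1 insertI2)
  then obtain xi xj :: int where x: "real_of_int N' * x $ i = real_of_int xi" "real_of_int N' * x $ j = real_of_int xj"
    by (auto elim!: Ints_cases)
  define a :: "int ^ 'n" where "a = (\<chi> k. if k = i then N' * p else if k = j then N' * q else 0)"
  have sum: "(\<Sum>k\<in>UNIV. real_of_int (a $ k) * y $ k) = real_of_int N' * (real_of_int p * y $ i + real_of_int q * y $ j)"
    for y :: "real ^ 'n"
  proof -
    have "(\<Sum>k\<in>UNIV. real_of_int (a $ k) * y $ k) = (\<Sum>k\<in>{i, j}. real_of_int (a $ k) * y $ k)"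
      by (rule sum.mono_neutral_right) (auto simp: a_def)
    then show ?thesis using ij by (simp add: a_def algebra_simps)
  qed
  show ?thesis
  proof
    show "a \<noteq> 0"
    proof
      assume "a = 0"
      then have "a $ i = 0" "a $ j = 0" by simp_all
      then show False using pq N'(1) ij(3) by (simp add: a_def)
    qed
    show "a $ k = 0" if "k \<notin> I" for k using that ij by (auto simp: a_def)
    show "(\<Sum>k\<in>UNIV. real_of_int (a $ k) * v $ k) = 0" by (simp add: sum pqv)
    have "(\<Sum>k\<in>UNIV. real_of_int (a $ k) * x $ k) = real_of_int p * (real_of_int N' * x $ i) + real_of_int q * (real_of_int N' * x $ j)"
      unfolding sum by (simp add: algebra_simps)
    then show "(\<Sum>k\<in>UNIV. real_of_int (a $ k) * x $ k) = real_of_int (p * xi + q * xj)"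
      by (simp add: x)
  qed
qed

section \<open>Local coordinates on the submanifold\<close>

text \<open>The strict derivative of \<phi> makes \<phi> locally Lipschitz, so its inverse \<psi> is
  bounded below on differences and has an injective derivative \<open>D\<close>. Some coordinate
  projection is injective, hence bounded below, on the image of \<open>L\<close> under
  \<open>D\<close>; half of that bound passes to \<psi> by strict differentiability.\<close>

lemma chart_coord_proj_lower_bound:
  fixes \<phi> \<psi> :: "real ^ 'n \<Rightarrow> real ^ 'n"
  assumes UV: "open U" "open V" "homeomorphism U V \<phi> \<psi>" "real_analytic_on \<phi> U" "real_analytic_on \<psi> V"
    and L: "subspace L" and a: "a \<in> V"
  obtains I c r where "card I = dim L" "c > 0" "r > 0" "ball a r \<subseteq> V"
    "\<And>y y'. y \<in> ball a r \<inter> L \<Longrightarrow> y' \<in> ball a r \<inter> L \<Longrightarrow> c * norm (y - y') \<le> norm (coord_proj I (\<psi> y - \<psi> y'))"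
proof -
  have \<psi>a: "\<psi> a \<in> U" using UV(3) a by (auto simp: homeomorphism_def)
  obtain E where E: "linear E" and Ed: "\<And>e. e > 0 \<Longrightarrow> \<exists>\<delta>>0. \<forall>x\<in>ball (\<psi> a) \<delta>. \<forall>y\<in>ball (\<psi> a) \<delta>. norm (\<phi> x - \<phi> y - E (x - y)) \<le> e * norm (x - y)"
    using real_analytic_at_strict_derivative UV(4) \<psi>a unfolding real_analytic_on_def by blast
  obtain B where B: "B > 0" "\<And>u. norm (E u) \<le> B * norm u" using linear_bounded_pos[OF E] by blast
  obtain \<delta> where \<delta>: "\<delta> > 0" "\<And>x y. x \<in> ball (\<psi> a) \<delta> \<Longrightarrow> y \<in> ball (\<psi> a) \<delta> \<Longrightarrow> norm (\<phi> x - \<phi> y - E (x - y)) \<le> 1 * norm (x - y)"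
    using Ed[of 1] by (metis zero_less_one)
  define K where "K = B + 1"
  have K: "K > 0" using B by (simp add: K_def)
  have "open (V \<inter> \<psi> -` ball (\<psi> a) \<delta>)"
    using UV(2,3) by (auto simp: homeomorphism_def intro: continuous_open_preimage)
  moreover have "a \<in> V \<inter> \<psi> -` ball (\<psi> a) \<delta>" using a \<delta>(1) by simp
  ultimately obtain \<delta>1 where \<delta>1: "\<delta>1 > 0" "ball a \<delta>1 \<subseteq> V \<inter> \<psi> -` ball (\<psi> a) \<delta>" using openE by blast
  have lower: "norm (y - y') \<le> K * norm (\<psi> y - \<psi> y')" if "y \<in> ball a \<delta>1" "y' \<in> ball a \<delta>1" for y y'
  proof -
    have y: "y \<in> V" "y' \<in> V" "\<psi> y \<in> ball (\<psi> a) \<delta>" "\<psi> y' \<in> ball (\<psi> a) \<delta>" using that \<delta>1(2) by auto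
    have "norm (y - y') = norm (\<phi> (\<psi> y) - \<phi> (\<psi> y'))" using y UV(3) by (auto simp: homeomorphism_def)
    also have "\<dots> \<le> norm (\<phi> (\<psi> y) - \<phi> (\<psi> y') - E (\<psi> y - \<psi> y')) + norm (E (\<psi> y - \<psi> y'))"
      using norm_triangle_ineq[of "\<phi> (\<psi> y) - \<phi> (\<psi> y') - E (\<psi> y - \<psi> y')" "E (\<psi> y - \<psi> y')"] by simp
    also have "\<dots> \<le> K * norm (\<psi> y - \<psi> y')"
      using \<delta>(2)[OF y(3,4)] B(2)[of "\<psi> y - \<psi> y'"] by (simp add: K_def algebra_simps)
    finally show ?thesis .
  qed
  obtain D where D: "linear D" and Dd: "\<And>e. e > 0 \<Longrightarrow> \<exists>\<delta>>0. \<forall>x\<in>ball a \<delta>. \<forall>y\<in>ball a \<delta>. norm (\<psi> x - \<psi> y - D (x - y)) \<le> e * norm (x - y)"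
    using real_analytic_at_strict_derivative UV(5) a unfolding real_analytic_on_def by blast
  \<comment> \<open>If \<open>D u = 0\<close> with \<open>u \<noteq> 0\<close>, then along a short
    multiple of \<open>u\<close> the map \<psi> moves by at most half of what \<open>lower\<close>
    demands.\<close>
  have Dinj: "u = 0" if "D u = 0" for u
  proof (rule ccontr)
    assume u: "u \<noteq> 0"
    obtain \<delta>2 where \<delta>2: "\<delta>2 > 0" "\<And>x y. x \<in> ball a \<delta>2 \<Longrightarrow> y \<in> ball a \<delta>2 \<Longrightarrow> norm (\<psi> x - \<psi> y - D (x - y)) \<le> 1 / (2 * K) * norm (x - y)"
      using Dd[of "1 / (2 * K)"] K by (metis zero_less_divide_1_iff zero_less_mult_iff zero_less_numeral)
    define s where "s = min \<delta>1 \<delta>2 / (2 * norm u)"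
    have s: "s > 0" "norm (s *\<^sub>R u) < \<delta>1" "norm (s *\<^sub>R u) < \<delta>2"
      using u \<delta>1(1) \<delta>2(1) by (auto simp: s_def min_def)
    have "norm (s *\<^sub>R u) \<le> K * norm (\<psi> (a + s *\<^sub>R u) - \<psi> a)"
      using lower[of "a + s *\<^sub>R u" a] s \<delta>1(1) by (simp add: dist_norm)
    also have "norm (\<psi> (a + s *\<^sub>R u) - \<psi> a) \<le> 1 / (2 * K) * norm (s *\<^sub>R u)"
      using \<delta>2(2)[of "a + s *\<^sub>R u" a] s \<delta>2(1) that by (simp add: dist_norm linear_cmul[OF D])
    finally show False using K s(1) u by simp
  qed
  then have "inj_on D (span L)" using linear_injective_0[OF D] by (auto simp: inj_on_def inj_def)
  then have dimDL: "dim (D ` L) = dim L" using D by (rule dim_image_eq[rotated])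
  obtain I where I: "card I = dim (D ` L)" "\<And>x. x \<in> D ` L \<Longrightarrow> coord_proj I x = 0 \<Longrightarrow> x = 0"
    using injective_coord_proj_exists[OF linear_subspace_image[OF D L]] by metis
  have lin: "linear (\<lambda>u. coord_proj I (D u))"
    using linear_compose[OF D linear_coord_proj[of I]] by (simp add: o_def)
  have "\<exists>c1>0. \<forall>u\<in>L. c1 * norm u \<le> norm (coord_proj I (D u))"
  proof (rule injective_imp_isometric)
    show "\<forall>x\<in>L. coord_proj I (D x) = 0 \<longrightarrow> x = 0" using I(2) Dinj by blast
    show "bounded_linear (\<lambda>u. coord_proj I (D u))" using lin by (simp add: linear_conv_bounded_linear)
  qed (use L closed_subspace in auto)
  then obtain c1 where c1: "c1 > 0" "\<And>u. u \<in> L \<Longrightarrow> c1 * norm u \<le> norm (coord_proj I (D u))" by blast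
  obtain \<delta>3 where \<delta>3: "\<delta>3 > 0" "\<And>x y. x \<in> ball a \<delta>3 \<Longrightarrow> y \<in> ball a \<delta>3 \<Longrightarrow> norm (\<psi> x - \<psi> y - D (x - y)) \<le> c1 / 2 * norm (x - y)"
    using Dd[of "c1 / 2"] c1(1) by (metis half_gt_zero)
  show ?thesis
  proof
    show "card I = dim L" using I(1) dimDL by simp
    show "c1 / 2 > 0" "min \<delta>1 \<delta>3 > 0" using c1 \<delta>1 \<delta>3 by auto
    show "ball a (min \<delta>1 \<delta>3) \<subseteq> V" using \<delta>1(2) by auto
    fix y y' assume y: "y \<in> ball a (min \<delta>1 \<delta>3) \<inter> L" "y' \<in> ball a (min \<delta>1 \<delta>3) \<inter> L"
    have "c1 * norm (y - y') \<le> norm (coord_proj I (D (y - y')))"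
      using y L by (intro c1(2)) (auto intro: subspace_diff)
    also have "D (y - y') = (\<psi> y - \<psi> y') - (\<psi> y - \<psi> y' - D (y - y'))" by simp
    also have "coord_proj I \<dots> = coord_proj I (\<psi> y - \<psi> y') - coord_proj I (\<psi> y - \<psi> y' - D (y - y'))"
      by (rule linear_diff[OF linear_coord_proj])
    also have "norm \<dots> \<le> norm (coord_proj I (\<psi> y - \<psi> y')) + norm (\<psi> y - \<psi> y' - D (y - y'))"
      using norm_triangle_ineq4 norm_coord_proj_le add_left_mono order_trans by blast
    also have "norm (\<psi> y - \<psi> y' - D (y - y')) \<le> c1 / 2 * norm (y - y')"
      using y by (intro \<delta>3(2)) auto
    finally show "c1 / 2 * norm (y - y') \<le> norm (coord_proj I (\<psi> y - \<psi> y'))" by simp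
  qed
qed

text \<open>The coordinates in \<open>I\<close> serve as local topological coordinates:
  \<open>lower_bound\<close> makes the coordinate map on \<open>N\<close> injective with Lipschitz
  inverse, and \<open>card_I\<close> matches the dimensions.\<close>

locale projected_chart =
  fixes \<psi> :: "real ^ 'n \<Rightarrow> real ^ 'n" and L N :: "(real ^ 'n) set" and I :: "'n set" and c :: real
  assumes subspace_L: "subspace L"
    and openin_N: "openin (top_of_set L) N" and N_nonempty: "N \<noteq> {}"
    and analytic: "\<And>y. y \<in> N \<Longrightarrow> real_analytic_at \<psi> y"
    and continuous: "continuous_on N \<psi>"
    and card_I: "card I = dim L" and c_pos: "c > 0"
    and lower_bound: "\<And>y y'. y \<in> N \<Longrightarrow> y' \<in> N \<Longrightarrow> c * norm (y - y') \<le> norm (coord_proj I (\<psi> y - \<psi> y'))"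
begin

lemma N_subset: "N \<subseteq> L" using openin_N by (rule openin_imp_subset)

lemma lower_bound': "y \<in> N \<Longrightarrow> y' \<in> N \<Longrightarrow> c * norm (y - y') \<le> norm (coord_proj I (\<psi> y) - coord_proj I (\<psi> y'))"
  using lower_bound by (simp add: linear_diff[OF linear_coord_proj])

text \<open>Invariance of domain takes the place of an inverse function theorem.\<close>

lemma openin_projection:
  assumes "openin (top_of_set L) S" "S \<subseteq> N"
  shows "openin (top_of_set (coord_subspace I)) ((\<lambda>y. coord_proj I (\<psi> y)) ` S)"
proof (rule invariance_of_domain_subspaces[OF assms(1) subspace_L subspace_coord_subspace])
  show "dim (coord_subspace I) \<le> dim L" using dim_coord_subspace_le card_I by metis
  have "continuous_on UNIV (coord_proj I)"
    by (intro linear_continuous_on) (simp add: linear_coord_proj flip: linear_conv_bounded_linear)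
  then show "continuous_on S (\<lambda>y. coord_proj I (\<psi> y))"
    using continuous_on_subset[OF continuous assms(2)] by (rule continuous_on_compose2) auto
  show "(\<lambda>y. coord_proj I (\<psi> y)) \<in> S \<rightarrow> coord_subspace I" by (auto simp: coord_proj_in)
  show "inj_on (\<lambda>y. coord_proj I (\<psi> y)) S"
  proof (rule inj_onI)
    fix y y' assume "y \<in> S" "y' \<in> S" "coord_proj I (\<psi> y) = coord_proj I (\<psi> y')"
    then have "c * norm (y - y') \<le> 0" using lower_bound'[of y y'] assms(2) by auto
    then show "y = y'" using c_pos by (simp add: mult_le_0_iff)
  qed
qed

lemma preimage_near:
  assumes "y0 \<in> S" "openin (top_of_set L) S" "S \<subseteq> N"
  obtains e where "e > 0"
    "\<And>v. v \<in> coord_subspace I \<Longrightarrow> norm v < e \<Longrightarrow> \<exists>y\<in>S. coord_proj I (\<psi> y) = coord_proj I (\<psi> y0) + v"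
proof -
  have "coord_proj I (\<psi> y0) \<in> (\<lambda>y. coord_proj I (\<psi> y)) ` S" using assms(1) by blast
  then obtain e where e: "e > 0" "ball (coord_proj I (\<psi> y0)) e \<inter> coord_subspace I \<subseteq> (\<lambda>y. coord_proj I (\<psi> y)) ` S"
    using openin_projection[OF assms(2,3)] unfolding openin_contains_ball by blast
  show ?thesis
  proof (rule that[OF e(1)])
    fix v :: "real ^ 'n" assume v: "v \<in> coord_subspace I" "norm v < e"
    then have "coord_proj I (\<psi> y0) + v \<in> ball (coord_proj I (\<psi> y0)) e \<inter> coord_subspace I"
      using subspace_add[OF subspace_coord_subspace coord_proj_in] by (simp add: dist_norm)
    then show "\<exists>y\<in>S. coord_proj I (\<psi> y) = coord_proj I (\<psi> y0) + v" using e(2) by force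
  qed
qed

text \<open>The derivative \<open>J\<close> of the coordinate map is an isomorphism from
  \<open>L\<close> onto \<open>coord_subspace I\<close>. So a rational \<open>v\<close> near
  \<open>J u0\<close> is the image of some \<open>uv\<close> near the centre \<open>u0\<close> of a
  sector without zeros of \<open>g\<close>. Points whose coordinates move by
  \<open>s *\<^sub>R v\<close> leave \<open>y0\<close> along \<open>s *\<^sub>R uv\<close> up to a
  small multiple of \<open>s\<close>, hence inside the sector.\<close>

lemma rational_direction:
  assumes y0: "y0 \<in> N" and g: "real_analytic_at g y0"
    and nz: "\<And>\<rho>. \<rho> > 0 \<Longrightarrow> \<exists>y\<in>N. dist y0 y < \<rho> \<and> g y \<noteq> (0::real)"
  obtains v where "v \<in> coord_subspace I" "\<And>i. v $ i \<in> \<rat>"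
    "\<And>\<epsilon>. \<epsilon> > 0 \<Longrightarrow> \<exists>s\<in>\<rat>. \<exists>y\<in>N. dist y0 y < \<epsilon> \<and> coord_proj I (\<psi> y) = coord_proj I (\<psi> y0) + s *\<^sub>R v \<and> g y \<noteq> 0"
proof -
  have sub: "s *\<^sub>R u \<in> L" if "u \<in> L" for s u using subspace_L that by (simp add: subspace_scale)
  have "\<not> (\<exists>\<rho>>0. \<forall>u\<in>L. norm u < \<rho> \<longrightarrow> g (y0 + u) = 0)"
  proof
    assume "\<exists>\<rho>>0. \<forall>u\<in>L. norm u < \<rho> \<longrightarrow> g (y0 + u) = 0"
    then obtain \<rho> where \<rho>: "\<rho> > 0" "\<And>u. u \<in> L \<Longrightarrow> norm u < \<rho> \<Longrightarrow> g (y0 + u) = 0" by blast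
    obtain y where y: "y \<in> N" "dist y0 y < \<rho>" "g y \<noteq> 0" using nz[OF \<rho>(1)] by blast
    have "y - y0 \<in> L" using y(1) y0 N_subset subspace_L by (auto intro: subspace_diff)
    then show False using \<rho>(2)[of "y - y0"] y by (simp add: dist_norm norm_minus_commute)
  qed
  then obtain u0 \<delta> \<eta> where u0: "u0 \<in> L" "\<delta> > 0" "\<eta> > 0"
    and sector: "\<And>s u. 0 < \<bar>s\<bar> \<Longrightarrow> \<bar>s\<bar> < \<delta> \<Longrightarrow> u \<in> L \<Longrightarrow> norm (u - s *\<^sub>R u0) \<le> \<eta> * \<bar>s\<bar> \<Longrightarrow> g (y0 + u) \<noteq> 0"
    using real_analytic_zero_or_nonzero_sector[OF g sub] by blast
  obtain D where D: "linear D" and Dd: "\<And>e. e > 0 \<Longrightarrow> \<exists>\<delta>>0. \<forall>x\<in>ball y0 \<delta>. \<forall>y\<in>ball y0 \<delta>. norm (\<psi> x - \<psi> y - D (x - y)) \<le> e * norm (x - y)"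
    using real_analytic_at_strict_derivative[OF analytic[OF y0]] by blast
  define J where "J u = coord_proj I (D u)" for u
  have J: "linear J"
    using linear_compose[OF D linear_coord_proj[of I]] by (simp add: o_def J_def[abs_def])
  have remainder: "norm (J (y - y0) - (coord_proj I (\<psi> y) - coord_proj I (\<psi> y0))) \<le> norm (\<psi> y - \<psi> y0 - D (y - y0))" for y
  proof -
    have "J (y - y0) - (coord_proj I (\<psi> y) - coord_proj I (\<psi> y0)) = - coord_proj I (\<psi> y - \<psi> y0 - D (y - y0))"
      by (simp add: J_def linear_diff[OF linear_coord_proj])
    then show ?thesis using norm_coord_proj_le by (metis norm_minus_cancel)
  qed
  obtain \<epsilon>N where \<epsilon>N: "\<epsilon>N > 0" "ball y0 \<epsilon>N \<inter> L \<subseteq> N"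
    using openin_N y0 unfolding openin_contains_ball by blast
  \<comment> \<open>Half of \<open>c\<close> survives the passage from \<psi> to its derivative, by
    comparing both along a short multiple of \<open>u\<close>.\<close>
  have Jlow: "c / 2 * norm u \<le> norm (J u)" if u: "u \<in> L" for u
  proof (cases "u = 0")
    case False
    obtain \<delta>' where \<delta>': "\<delta>' > 0" "\<And>x y. x \<in> ball y0 \<delta>' \<Longrightarrow> y \<in> ball y0 \<delta>' \<Longrightarrow> norm (\<psi> x - \<psi> y - D (x - y)) \<le> c / 2 * norm (x - y)"
      using Dd[of "c / 2"] c_pos by (metis half_gt_zero)
    define s where "s = min \<epsilon>N \<delta>' / (2 * norm u)"
    have s: "s > 0" "norm (s *\<^sub>R u) < \<epsilon>N" "norm (s *\<^sub>R u) < \<delta>'"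
      using False \<epsilon>N(1) \<delta>'(1) by (auto simp: s_def min_def)
    define y where "y = y0 + s *\<^sub>R u"
    have "y \<in> L" using sub[OF u] y0 N_subset subspace_L by (auto simp: y_def intro: subspace_add)
    then have y: "y \<in> N" "y - y0 = s *\<^sub>R u" using s(2) \<epsilon>N(2) by (auto simp: y_def dist_norm)
    have "c * norm (s *\<^sub>R u) \<le> norm (coord_proj I (\<psi> y) - coord_proj I (\<psi> y0))"
      using lower_bound'[OF y(1) y0] y(2) by simp
    also have "\<dots> \<le> norm (J (y - y0)) + norm (\<psi> y - \<psi> y0 - D (y - y0))"
      using remainder[of y] norm_triangle_sub[of "coord_proj I (\<psi> y) - coord_proj I (\<psi> y0)" "J (y - y0)"]
      by (simp add: norm_minus_commute)
    also have "norm (\<psi> y - \<psi> y0 - D (y - y0)) \<le> c / 2 * norm (y - y0)"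
      using s(3) \<delta>'(1) by (intro \<delta>'(2)) (auto simp: y_def dist_norm)
    finally have "c * (s * norm u) \<le> s * norm (J u) + c / 2 * (s * norm u)"
      using s(1) by (simp add: y(2) linear_cmul[OF J])
    moreover have "c * (s * norm u) = 2 * (s * (c / 2 * norm u))" "c / 2 * (s * norm u) = s * (c / 2 * norm u)"
      by simp_all
    ultimately have "s * (c / 2 * norm u) \<le> s * norm (J u)" by linarith
    then show ?thesis using s(1) by (rule mult_left_le_imp_le)
  qed simp
  have "u = 0" if "u \<in> L" "J u = 0" for u
    using Jlow[OF that(1)] that(2) c_pos by (simp add: mult_le_0_iff)
  then have "inj_on J (span L)"
    unfolding span_eq_iff[THEN iffD2, OF subspace_L]
    using linear_injective_on_subspace_0[OF J subspace_L] by blast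
  then have "dim (J ` L) = dim L" using J by (rule dim_image_eq[rotated])
  moreover have "J ` L \<subseteq> coord_subspace I" by (auto simp: J_def coord_proj_in)
  ultimately have JL: "J ` L = coord_subspace I"
    using dim_coord_subspace_le[of I] card_I
    by (intro subspace_dim_equal linear_subspace_image[OF J subspace_L] subspace_coord_subspace) auto
  \<comment> \<open>The factor \<open>c / 2\<close> is the one that \<open>Jlow\<close> costs; half
    of \<eta> is spent on \<open>uv\<close>, the other half on the nonlinearity of \<psi>.\<close>
  obtain v where v: "v \<in> coord_subspace I" "\<And>i. v $ i \<in> \<rat>" "norm (v - J u0) < c / 2 * (\<eta> / 2)"
    using coord_subspace_rational_dense[of "J u0" I "c / 2 * (\<eta> / 2)"] JL u0 c_pos by auto
  have "v \<in> J ` L" using v(1) JL by simp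
  then obtain uv where uv: "uv \<in> L" "J uv = v" by blast
  have "c / 2 * norm (uv - u0) \<le> norm (v - J u0)"
    using Jlow[of "uv - u0"] uv u0(1) subspace_L by (simp add: subspace_diff linear_diff[OF J])
  then have "c / 2 * norm (uv - u0) < c / 2 * (\<eta> / 2)" using v(3) by linarith
  then have uv_u0: "norm (uv - u0) < \<eta> / 2" using c_pos by (simp only: mult_less_cancel_left_pos half_gt_zero)
  have "\<exists>s\<in>\<rat>. \<exists>y\<in>N. dist y0 y < \<epsilon> \<and> coord_proj I (\<psi> y) = coord_proj I (\<psi> y0) + s *\<^sub>R v \<and> g y \<noteq> 0" if "\<epsilon> > 0" for \<epsilon>
  proof -
    \<comment> \<open>Chosen such that
      \<open>e * (s * (norm v + 1) / c) = c / 2 * (\<eta> / 2 * s)\<close>; the summand 1 allows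
      \<open>v = 0\<close>.\<close>
    define e where "e = \<eta> * c\<^sup>2 / (4 * (norm v + 1))"
    have v1: "norm v + 1 > 0" by (simp add: add_nonneg_pos)
    have e: "e > 0" using u0(3) c_pos v1 by (simp add: e_def)
    obtain \<delta>' where \<delta>': "\<delta>' > 0" "\<And>x y. x \<in> ball y0 \<delta>' \<Longrightarrow> y \<in> ball y0 \<delta>' \<Longrightarrow> norm (\<psi> x - \<psi> y - D (x - y)) \<le> e * norm (x - y)"
      using Dd[OF e] by metis
    define S where "S = N \<inter> ball y0 (min \<epsilon> \<delta>')"
    have S: "y0 \<in> S" "openin (top_of_set L) S" "S \<subseteq> N"
      using y0 that \<delta>'(1) openin_N by (auto simp: S_def intro: openin_Int_open)
    obtain e1 where e1: "e1 > 0"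
      "\<And>v. v \<in> coord_subspace I \<Longrightarrow> norm v < e1 \<Longrightarrow> \<exists>y\<in>S. coord_proj I (\<psi> y) = coord_proj I (\<psi> y0) + v"
      using preimage_near[OF S] by blast
    have "min \<delta> (e1 / (norm v + 1)) > 0" using u0(2) e1(1) v1 by simp
    then obtain s where s: "s \<in> \<rat>" "0 < s" "s < min \<delta> (e1 / (norm v + 1))"
      using Rats_dense_in_real by blast
    have "s * (norm v + 1) < e1" using s(3) v1 by (simp add: pos_less_divide_eq)
    then have "norm (s *\<^sub>R v) < e1" using s(2) by (simp add: algebra_simps)
    then obtain y where y: "y \<in> S" "coord_proj I (\<psi> y) = coord_proj I (\<psi> y0) + s *\<^sub>R v"
      using e1(2)[of "s *\<^sub>R v"] v(1) subspace_scale[OF subspace_coord_subspace] by blast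
    have yN: "y \<in> N" using y(1) S(3) by blast
    have yL: "y - y0 \<in> L" using yN y0 N_subset subspace_L by (auto intro: subspace_diff)
    have "c * norm (y - y0) \<le> s * norm v"
      using lower_bound'[OF yN y0] y(2) s(2) by simp
    then have ny: "norm (y - y0) \<le> s * (norm v + 1) / c"
      using c_pos s(2) by (simp add: field_simps)
    have "c / 2 * norm (y - y0 - s *\<^sub>R uv) \<le> norm (J (y - y0 - s *\<^sub>R uv))"
      by (rule Jlow[OF subspace_diff[OF subspace_L yL sub[OF uv(1)]]])
    also have "J (y - y0 - s *\<^sub>R uv) = J (y - y0) - (coord_proj I (\<psi> y) - coord_proj I (\<psi> y0))"
      using y(2) uv(2) by (simp add: linear_diff[OF J] linear_cmul[OF J])
    also have "norm \<dots> \<le> norm (\<psi> y - \<psi> y0 - D (y - y0))" by (rule remainder)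
    also have "\<dots> \<le> e * norm (y - y0)" using y(1) \<delta>'(1) by (intro \<delta>'(2)) (auto simp: S_def)
    also have "\<dots> \<le> e * (s * (norm v + 1) / c)" using ny e by (intro mult_left_mono) auto
    also have "\<dots> = c / 2 * (\<eta> / 2 * s)"
    proof -
      have "\<eta> * c\<^sup>2 / (4 * t) * (s * t / c) = c / 2 * (\<eta> / 2 * s)" if "t > 0" for t
        using that c_pos by (simp add: power2_eq_square)
      then show ?thesis unfolding e_def using v1 by blast
    qed
    finally have "norm (y - y0 - s *\<^sub>R uv) \<le> \<eta> / 2 * s" using c_pos by simp
    moreover have "norm (s *\<^sub>R uv - s *\<^sub>R u0) \<le> \<eta> / 2 * s"
      using uv_u0 s(2) by (simp add: mult.commute flip: scaleR_diff_right)
    moreover have "y - y0 - s *\<^sub>R u0 = (y - y0 - s *\<^sub>R uv) + (s *\<^sub>R uv - s *\<^sub>R u0)" by simp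
    then have "norm (y - y0 - s *\<^sub>R u0) \<le> norm (y - y0 - s *\<^sub>R uv) + norm (s *\<^sub>R uv - s *\<^sub>R u0)"
      by (metis norm_triangle_ineq)
    ultimately have "norm (y - y0 - s *\<^sub>R u0) \<le> \<eta> * \<bar>s\<bar>" using s(2) by simp
    then have "g (y0 + (y - y0)) \<noteq> 0" using s yL by (intro sector[of s]) auto
    then show ?thesis using y yN s(1) by (auto simp: S_def)
  qed
  with v(1,2) show ?thesis by (rule that)
qed

definition rational_points :: "(real ^ 'n) set" where
  "rational_points = {y \<in> N. \<forall>i\<in>I. \<psi> y $ i \<in> \<rat>}"

lemma rational_points_nonempty: "rational_points \<noteq> {}"
proof -
  obtain y0 where y0: "y0 \<in> N" using N_nonempty by blast
  obtain e where e: "e > 0"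
    "\<And>v. v \<in> coord_subspace I \<Longrightarrow> norm v < e \<Longrightarrow> \<exists>y\<in>N. coord_proj I (\<psi> y) = coord_proj I (\<psi> y0) + v"
    using preimage_near[OF y0 openin_N] by blast
  obtain v where v: "v \<in> coord_subspace I" "\<And>i. v $ i \<in> \<rat>" "norm (v - coord_proj I (\<psi> y0)) < e"
    using coord_subspace_rational_dense[OF coord_proj_in e(1)] by blast
  have "v - coord_proj I (\<psi> y0) \<in> coord_subspace I"
    using v(1) by (intro subspace_diff subspace_coord_subspace coord_proj_in)
  then obtain y where y: "y \<in> N" "coord_proj I (\<psi> y) = v" using e(2) v(3) by fastforce
  have "\<psi> y $ i \<in> \<rat>" if "i \<in> I" for i
    using v(2)[of i] y(2) that by (auto simp: coord_proj_def)
  then show ?thesis using y(1) by (auto simp: rational_points_def)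
qed

text \<open>By openness of the projection, coordinate \<open>i\<close> can be increased slightly.
  This serves to avoid the hyperplanes on which coordinate \<open>i\<close> equals that of a given
  point, whose right-hand sides may be irrational.\<close>

lemma coordinate_not_constant:
  assumes "y0 \<in> N" "i \<in> I" "\<rho> > 0"
  shows "\<exists>y\<in>N. dist y0 y < \<rho> \<and> \<psi> y $ i \<noteq> \<beta>"
proof (rule ccontr)
  assume "\<not> ?thesis"
  then have const: "\<psi> y $ i = \<beta>" if "y \<in> N" "dist y0 y < \<rho>" for y using that by blast
  have "y0 \<in> N \<inter> ball y0 \<rho>" "openin (top_of_set L) (N \<inter> ball y0 \<rho>)" "N \<inter> ball y0 \<rho> \<subseteq> N"
    using assms openin_N by (auto intro: openin_Int_open)
  then obtain e where e: "e > 0"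
    "\<And>v. v \<in> coord_subspace I \<Longrightarrow> norm v < e \<Longrightarrow> \<exists>y\<in>N \<inter> ball y0 \<rho>. coord_proj I (\<psi> y) = coord_proj I (\<psi> y0) + v"
    using preimage_near by metis
  have "(e / 2) *\<^sub>R axis i 1 \<in> coord_subspace I"
    using assms(2) by (auto simp: coord_subspace_def axis_def)
  moreover have "norm ((e / 2) *\<^sub>R axis i 1 :: real ^ 'n) < e" using e(1) by simp
  ultimately obtain y where y: "y \<in> N" "dist y0 y < \<rho>" "coord_proj I (\<psi> y) = coord_proj I (\<psi> y0) + (e / 2) *\<^sub>R axis i 1"
    using e(2) by fastforce
  have "coord_proj I (\<psi> y) $ i = coord_proj I (\<psi> y0) $ i + e / 2" unfolding y(3) by simp
  then have "\<psi> y $ i = \<psi> y0 $ i + e / 2" using assms(2) by (simp add: coord_proj_def)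
  then show False using const y(1,2) const[of y0] assms e(1) by simp
qed

text \<open>Supplies the step of \<open>nested_hyperplane_construction\<close>. The normal
  \<open>a\<close> is supported in \<open>I\<close> and orthogonal to \<open>v\<close>, so a point
  whose coordinates in \<open>I\<close> move along \<open>v\<close> stays on the hyperplane, however
  its other coordinates move.\<close>

lemma hyperplane_step:
  assumes "dim L \<ge> 2" and y0: "y0 \<in> rational_points"
    and nz: "\<And>\<rho>. \<rho> > 0 \<Longrightarrow> \<exists>y\<in>N. dist y0 y < \<rho> \<and> \<alpha> \<bullet> \<psi> y \<noteq> \<beta>"
  shows "\<exists>a b. a \<noteq> 0 \<and> (\<Sum>i\<in>UNIV. real_of_int (a $ i) * \<psi> y0 $ i) = real_of_int b \<and>
       (\<forall>\<epsilon>>0. \<exists>y\<in>rational_points. dist y0 y < \<epsilon> \<and>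
         (\<Sum>i\<in>UNIV. real_of_int (a $ i) * \<psi> y $ i) = real_of_int b \<and> \<alpha> \<bullet> \<psi> y \<noteq> \<beta>)"
proof -
  have y0N: "y0 \<in> N" and rat: "\<And>i. i \<in> I \<Longrightarrow> \<psi> y0 $ i \<in> \<rat>"
    using y0 by (auto simp: rational_points_def)
  have "real_analytic_at (\<lambda>y. \<alpha> \<bullet> \<psi> y - \<beta>) y0"
    by (intro real_analytic_at_diff_const real_analytic_at_inner analytic y0N)
  from rational_direction[OF y0N this] nz
  obtain v where v: "v \<in> coord_subspace I" "\<And>i. v $ i \<in> \<rat>"
    "\<And>\<epsilon>. \<epsilon> > 0 \<Longrightarrow> \<exists>s\<in>\<rat>. \<exists>y\<in>N. dist y0 y < \<epsilon> \<and> coord_proj I (\<psi> y) = coord_proj I (\<psi> y0) + s *\<^sub>R v \<and> \<alpha> \<bullet> \<psi> y - \<beta> \<noteq> 0"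
    by auto
  have "card I \<ge> 2" using assms(1) card_I by simp
  from integer_hyperplane_through_direction[OF this v(2) rat]
  obtain a b where a: "a \<noteq> 0" "\<And>i. i \<notin> I \<Longrightarrow> a $ i = 0"
    "(\<Sum>i\<in>UNIV. real_of_int (a $ i) * v $ i) = 0"
    "(\<Sum>i\<in>UNIV. real_of_int (a $ i) * \<psi> y0 $ i) = real_of_int b" by blast
  have "\<exists>y\<in>rational_points. dist y0 y < \<epsilon> \<and>
         (\<Sum>i\<in>UNIV. real_of_int (a $ i) * \<psi> y $ i) = real_of_int b \<and> \<alpha> \<bullet> \<psi> y \<noteq> \<beta>" if "\<epsilon> > 0" for \<epsilon>
  proof -
    obtain s y where y: "s \<in> \<rat>" "y \<in> N" "dist y0 y < \<epsilon>"
      "coord_proj I (\<psi> y) = coord_proj I (\<psi> y0) + s *\<^sub>R v" "\<alpha> \<bullet> \<psi> y - \<beta> \<noteq> 0"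
      using v(3)[OF \<open>\<epsilon> > 0\<close>] by blast
    have \<psi>y: "\<psi> y $ i = \<psi> y0 $ i + s * v $ i" if "i \<in> I" for i
    proof -
      have "coord_proj I (\<psi> y) $ i = coord_proj I (\<psi> y0) $ i + s * v $ i" unfolding y(4) by simp
      then show ?thesis using that by (simp add: coord_proj_def)
    qed
    have "real_of_int (a $ i) * \<psi> y $ i = real_of_int (a $ i) * \<psi> y0 $ i + s * (real_of_int (a $ i) * v $ i)" for i
      using \<psi>y[of i] a(2)[of i] by (cases "i \<in> I") (auto simp: algebra_simps)
    then have "(\<Sum>i\<in>UNIV. real_of_int (a $ i) * \<psi> y $ i) = real_of_int b"
      using a(3,4) by (simp add: sum.distrib flip: sum_distrib_left)
    moreover have "y \<in> rational_points"
      using y(1,2) \<psi>y rat v(2) by (auto simp: rational_points_def)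
    ultimately show ?thesis using y(3,5) by auto
  qed
  with a(1,4) show ?thesis by blast
qed

end

section \<open>Singular vectors on the submanifold\<close>

lemma countable_rational_vectors: "countable {a :: real ^ 'n. \<forall>i. a $ i \<in> \<rat>}"
proof (rule countable_subset)
  show "{a :: real ^ 'n. \<forall>i. a $ i \<in> \<rat>} \<subseteq> vec_lambda ` (PiE UNIV (\<lambda>_. \<rat>))"
  proof
    fix a :: "real ^ 'n" assume "a \<in> {a. \<forall>i. a $ i \<in> \<rat>}"
    then have "a = vec_lambda (\<lambda>i. a $ i)" "(\<lambda>i. a $ i) \<in> PiE UNIV (\<lambda>_. \<rat>)" by auto
    then show "a \<in> vec_lambda ` (PiE UNIV (\<lambda>_. \<rat>))" by blast
  qed
  show "countable (vec_lambda ` (PiE UNIV (\<lambda>_. \<rat>)) :: (real ^ 'n) set)"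
    by (intro countable_image countable_PiE) (auto simp: countable_rat)
qed

theorem theorem1p3:
  fixes M :: "(real ^ 'n) set" and d :: nat
  assumes "CARD('n) \<ge> 2"
    and "real_analytic_submanifold d M"
    and "connected M"
    and "d \<ge> 2"
    and "\<not> (\<exists>H. rational_affine_hyperplane H \<and> M \<subseteq> H)"
  shows "uncountable {x \<in> M.
           \<not> (\<exists>H. rational_affine_hyperplane H \<and> x \<in> H) \<and>
           (\<forall>w. is_weight w \<and> (\<forall>i. 0 < w $ i \<and> w $ i < 1) \<longrightarrow> weighted_singular w x)}"
    (is "uncountable ?S")
proof
  assume countable: "countable ?S"
  have axis: "axis i 1 \<noteq> (0 :: real ^ 'n)" "\<forall>j. (axis i 1 :: real ^ 'n) $ j \<in> \<rat>" for i
    by (simp_all add: axis_eq_0_iff) (simp add: axis_def)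
  \<comment> \<open>Some rational hyperplane exists and would contain an empty
    \<open>M\<close>.\<close>
  then have "rational_affine_hyperplane {x :: real ^ 'n. axis undefined 1 \<bullet> x = 0}"
    unfolding rational_affine_hyperplane_def using Rats_0 by blast
  then have "M \<noteq> {}" using assms(5) by blast
  then obtain x0 where x0: "x0 \<in> M" by blast
  obtain U V \<phi> \<psi> and L :: "(real ^ 'n) set" where ch: "open U" "open V" "x0 \<in> U" "homeomorphism U V \<phi> \<psi>"
    "real_analytic_on \<phi> U" "real_analytic_on \<psi> V" "subspace L" "dim L = d" "\<phi> ` (U \<inter> M) = V \<inter> L"
    by (rule real_analytic_submanifold_chart[OF assms(2) x0])
  define a0 where "a0 = \<phi> x0"
  have a0: "a0 \<in> V" "a0 \<in> L" using ch(3,9) x0 by (auto simp: a0_def)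
  obtain I c r where Icr: "card I = dim L" "c > 0" "r > 0" "ball a0 r \<subseteq> V"
    and low: "\<And>y y'. y \<in> ball a0 r \<inter> L \<Longrightarrow> y' \<in> ball a0 r \<inter> L \<Longrightarrow> c * norm (y - y') \<le> norm (coord_proj I (\<psi> y - \<psi> y'))"
    using chart_coord_proj_lower_bound[OF ch(1,2,4,5,6,7) a0(1)] by metis
  define N where "N = ball a0 r \<inter> L"
  have NV: "N \<subseteq> V" "N \<subseteq> L" using Icr(4) by (auto simp: N_def)
  have \<phi>\<psi>: "\<phi> (\<psi> y) = y" "\<psi> y \<in> U \<inter> M" if y: "y \<in> V \<inter> L" for y
  proof -
    obtain u where "u \<in> U \<inter> M" "y = \<phi> u" using ch(9) y by blast
    then show "\<phi> (\<psi> y) = y" "\<psi> y \<in> U \<inter> M" using ch(4) by (auto simp: homeomorphism_def)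
  qed
  have cont: "continuous_on V \<psi>" using ch(4) by (simp add: homeomorphism_def)
  interpret projected_chart \<psi> L N I c
  proof
    show "openin (top_of_set L) N" unfolding N_def by (subst Int_commute) (simp add: openin_open_Int)
    have "a0 \<in> N" using a0(2) Icr(3) by (simp add: N_def)
    then show "N \<noteq> {}" by blast
    show "real_analytic_at \<psi> y" if "y \<in> N" for y using ch(6) NV(1) that by (auto simp: real_analytic_on_def)
    show "continuous_on N \<psi>" using cont NV(1) by (rule continuous_on_subset)
  qed (use ch(7) Icr low in \<open>auto simp: N_def\<close>)
  have "card I \<noteq> 0" using Icr(1) ch(8) assms(4) by simp
  then obtain i0 where i0: "i0 \<in> I" by fastforce
  \<comment> \<open>The rational hyperplanes and, for each \<open>x\<close> in the supposedly
    countable set, the hyperplane of points sharing coordinate \<open>i0\<close> with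
    \<open>x\<close>; \<open>i0\<close> is in \<open>I\<close> so that
    \<open>coordinate_not_constant\<close> applies.\<close>
  define F where "F = {(\<alpha> :: real ^ 'n, \<beta> :: real). \<alpha> \<noteq> 0 \<and> (\<forall>i. \<alpha> $ i \<in> \<rat>) \<and> \<beta> \<in> \<rat>} \<union> (\<lambda>x. (axis i0 1, x $ i0)) ` ?S"
  have "{(\<alpha> :: real ^ 'n, \<beta>). \<alpha> \<noteq> 0 \<and> (\<forall>i. \<alpha> $ i \<in> \<rat>) \<and> \<beta> \<in> \<rat>} \<subseteq> {\<alpha>. \<forall>i. \<alpha> $ i \<in> \<rat>} \<times> (\<rat> :: real set)"
    by auto
  then have "countable {(\<alpha> :: real ^ 'n, \<beta>). \<alpha> \<noteq> 0 \<and> (\<forall>i. \<alpha> $ i \<in> \<rat>) \<and> (\<beta> :: real) \<in> \<rat>}"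
    by (rule countable_subset) (intro countable_SIGMA countable_rational_vectors countable_rat)
  then have cF: "countable F" unfolding F_def using countable by (intro countable_Un countable_image)
  have "(axis i0 1, 0) \<in> F" using axis by (simp add: F_def)
  then have "F \<noteq> {}" by blast
  then have rangeF: "range (from_nat_into F) = F" using cF by (intro range_from_nat_into)
  have nz: "\<exists>y\<in>N. dist y0 y < \<rho> \<and> \<alpha> \<bullet> \<psi> y \<noteq> \<beta>" if F: "(\<alpha>, \<beta>) \<in> F" and y0: "y0 \<in> N" and \<rho>: "\<rho> > 0" for \<alpha> \<beta> y0 \<rho>
    using F unfolding F_def
  proof (elim UnE)
    assume "(\<alpha>, \<beta>) \<in> {(\<alpha>, \<beta>). \<alpha> \<noteq> 0 \<and> (\<forall>i. \<alpha> $ i \<in> \<rat>) \<and> \<beta> \<in> \<rat>}"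
    then have H: "rational_affine_hyperplane {x. \<alpha> \<bullet> x = \<beta>}"
      unfolding rational_affine_hyperplane_def by blast
    show ?thesis
    proof (rule ccontr)
      assume "\<not> ?thesis"
      then have eq: "\<alpha> \<bullet> \<psi> y = \<beta>" if "y \<in> N" "dist y0 y < \<rho>" for y using that by blast
      \<comment> \<open>\<open>W\<close> is open in the ambient space and meets \<open>M\<close>
        only in points with parameters in \<open>N\<close> near \<open>y0\<close>, so an equation
        valid there spreads to all of \<open>M\<close>.\<close>
      define W where "W = U \<inter> \<phi> -` (ball a0 r \<inter> ball y0 \<rho>)"
      have "open W" unfolding W_def
        using ch(1,4) by (intro continuous_open_preimage) (auto simp: homeomorphism_def)
      moreover have "\<psi> y0 \<in> W \<inter> M"
        using \<phi>\<psi>[of y0] y0 NV \<rho> by (auto simp: W_def N_def)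
      moreover have "\<alpha> \<bullet> x = \<beta>" if "x \<in> W \<inter> M" for x
      proof -
        have "\<phi> x \<in> N" using ch(9) that by (auto simp: W_def N_def)
        moreover have "\<psi> (\<phi> x) = x" using ch(4) that by (auto simp: W_def homeomorphism_def)
        ultimately show ?thesis using eq[of "\<phi> x"] that by (auto simp: W_def)
      qed
      ultimately have "M \<subseteq> {x. \<alpha> \<bullet> x = \<beta>}"
        using real_analytic_submanifold_in_hyperplane[OF assms(2,3)] by blast
      with H assms(5) show False by blast
    qed
  next
    assume "(\<alpha>, \<beta>) \<in> (\<lambda>x. (axis i0 1, x $ i0)) ` ?S"
    then have "\<alpha> = axis i0 1" by auto
    then show ?thesis using coordinate_not_constant[OF y0 i0 \<rho>] by (simp add: inner_axis')
  qed
  define \<alpha> where "\<alpha> k = fst (from_nat_into F k)" for k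
  define \<beta> where "\<beta> k = snd (from_nat_into F k)" for k
  have \<alpha>\<beta>: "(\<alpha> k, \<beta> k) \<in> F" for k using rangeF by (auto simp: \<alpha>_def \<beta>_def)
  have cball: "\<exists>\<epsilon>>0. cball y \<epsilon> \<inter> L \<subseteq> N" if "y \<in> N" for y
    using openin_N that unfolding openin_contains_cball by blast
  have RN: "rational_points \<subseteq> N" by (auto simp: rational_points_def)
  have "dim L \<ge> 2" using ch(8) assms(4) by simp
  then have step: "\<exists>a b. a \<noteq> 0 \<and> (\<Sum>i\<in>UNIV. real_of_int (a $ i) * \<psi> y $ i) = real_of_int b \<and>
       (\<forall>\<epsilon>>0. \<exists>y'\<in>rational_points. dist y y' < \<epsilon> \<and>
         (\<Sum>i\<in>UNIV. real_of_int (a $ i) * \<psi> y' $ i) = real_of_int b \<and> \<alpha> k \<bullet> \<psi> y' \<noteq> \<beta> k)"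
    if "y \<in> rational_points" for y k
    using that RN nz[OF \<alpha>\<beta>] by (intro hyperplane_step) blast+
  obtain y a b where y: "y \<in> N" "\<And>k. a k \<noteq> 0"
    "\<And>k. \<bar>(\<Sum>i\<in>UNIV. real_of_int (a k $ i) * \<psi> y $ i) - real_of_int (b k)\<bar> \<le> closeness k (a (Suc k))"
    "\<And>k. \<alpha> k \<bullet> \<psi> y \<noteq> \<beta> k"
    by (rule nested_hyperplane_construction[where \<Psi> = closeness and \<alpha> = \<alpha> and \<beta> = \<beta>, OF closed_subspace[OF ch(7)] NV(2) cball continuous RN
          rational_points_nonempty closeness_pos step]) blast+
  have avoid: "\<alpha>' \<bullet> \<psi> y \<noteq> \<beta>'" if "(\<alpha>', \<beta>') \<in> F" for \<alpha>' \<beta>'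
  proof -
    have "(\<alpha>', \<beta>') \<in> range (from_nat_into F)" using that by (simp only: rangeF)
    then obtain k where k: "from_nat_into F k = (\<alpha>', \<beta>')" by auto
    show ?thesis using y(4)[of k] unfolding \<alpha>_def \<beta>_def k by simp
  qed
  have "\<psi> y \<in> M" using \<phi>\<psi>[of y] y(1) NV by auto
  moreover have "\<not> (\<exists>H. rational_affine_hyperplane H \<and> \<psi> y \<in> H)"
  proof
    assume "\<exists>H. rational_affine_hyperplane H \<and> \<psi> y \<in> H"
    then obtain \<alpha>' \<beta>' where "\<alpha>' \<noteq> 0" "\<forall>i. \<alpha>' $ i \<in> \<rat>" "\<beta>' \<in> \<rat>" "\<alpha>' \<bullet> \<psi> y = \<beta>'"
      unfolding rational_affine_hyperplane_def by blast
    then show False using avoid[of \<alpha>' \<beta>'] by (auto simp: F_def)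
  qed
  moreover have "weighted_singular w (\<psi> y)" if "is_weight w \<and> (\<forall>i. 0 < w $ i \<and> w $ i < 1)" for w
    using weighted_singular_if_close_hyperplanes[OF y(2,3)] that by blast
  ultimately have "\<psi> y \<in> ?S" by blast
  \<comment> \<open>The hyperplane that \<open>F\<close> now contains for the new point passes
    through it, although all of \<open>F\<close> was avoided.\<close>
  then have "(axis i0 1, \<psi> y $ i0) \<in> F" unfolding F_def by blast
  from avoid[OF this] show False by (simp add: inner_axis')
qed

end
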